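(* Let $R$ be a commutative Noetherian local ring and let $M \neq 0$ be an $R$-module. Then the following are equivalent: (i) $M$ is simple torsion-free. (ii) There is a maximal element $\mathfrak{p}$ of $\operatorname{Ass}(R)$ (with respect to inclusion) and an injective $R$-homomorphism $M \hookrightarrow \kappa(\mathfrak{p})$.
   Context: $\kappa(\mathfrak{p}) = R_{\mathfrak{p}}/\mathfrak{p}R_{\mathfrak{p}}$ is regarded as an $R$-module. $\operatorname{Ass}(R)$ is the set of associated primes of the $R$-module $R$. An $R$-module $M$ is torsion-free if for every non-zero-divisor $r \in R$ multiplication by $r$ on $M$ is injective. $M$ is called simple torsion-free if $M$ is torsion-free, $M \neq 0$, and for every submodule $0 \neq U \subsetneq M$ the factor module $M/U$ is not torsion-free. *)

theory Defs
  imports "HOL-Algebra.Module" "HOL-Algebra.Ring_Divisibility"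
begin

section \<open>Rings and modules\<close>

text \<open>The zero ring has no maximal ideal, so it is not local.\<close>

locale local_ring = cring R for R (structure) +
  assumes ex1_maximal: "\<exists>!\<mm>. maximalideal \<mm> R"

text \<open>
  Module records have (irrelevant) multiplication and unit fields because the library record extends
  that of rings; they are left unspecified where no ring structure is at hand.
\<close>

definition self_module :: "('a, 'c) ring_scheme \<Rightarrow> ('a, 'a) module"
  where "self_module R =
    \<lparr>carrier = carrier R, monoid.mult = monoid.mult R, one = one R, zero = zero R,
     add = add R, smult = monoid.mult R\<rparr>"

definition quot_module ::
  "('a, 'c) ring_scheme \<Rightarrow> ('a, 'b, 'd) module_scheme \<Rightarrow> 'b set \<Rightarrow> ('a, 'b set) module"
  where "quot_module R M U =
    \<lparr>carrier = a_rcosets\<^bsub>M\<^esub> U, monoid.mult = undefined, one = undefined, zero = U, add = set_add M,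
     smult = (\<lambda>r X. \<Union>x\<in>X. U +>\<^bsub>M\<^esub> (r \<odot>\<^bsub>M\<^esub> x))\<rparr>"

definition module_homs ::
  "('a, 'c) ring_scheme \<Rightarrow> ('a, 'b, 'd) module_scheme \<Rightarrow> ('a, 'e, 'f) module_scheme \<Rightarrow> ('b \<Rightarrow> 'e) set"
  where "module_homs R M N =
    {h. h \<in> carrier M \<rightarrow> carrier N \<and>
        (\<forall>x\<in>carrier M. \<forall>y\<in>carrier M. h (x \<oplus>\<^bsub>M\<^esub> y) = h x \<oplus>\<^bsub>N\<^esub> h y) \<and>
        (\<forall>r\<in>carrier R. \<forall>x\<in>carrier M. h (r \<odot>\<^bsub>M\<^esub> x) = r \<odot>\<^bsub>N\<^esub> h x)}"


section \<open>Associated primes\<close>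

definition annihilator :: "('a, 'c) ring_scheme \<Rightarrow> ('a, 'b, 'd) module_scheme \<Rightarrow> 'b \<Rightarrow> 'a set"
  where "annihilator R M x = {r \<in> carrier R. r \<odot>\<^bsub>M\<^esub> x = \<zero>\<^bsub>M\<^esub>}"

definition Ass :: "('a, 'c) ring_scheme \<Rightarrow> ('a, 'b, 'd) module_scheme \<Rightarrow> 'a set set"
  where "Ass R M = {\<pp>. primeideal \<pp> R \<and> (\<exists>x\<in>carrier M. \<pp> = annihilator R M x)}"

definition maximal_in :: "'a set \<Rightarrow> 'a set set \<Rightarrow> bool"
  where "maximal_in P A \<longleftrightarrow> P \<in> A \<and> (\<forall>Q\<in>A. P \<subseteq> Q \<longrightarrow> Q = P)"


section \<open>Torsion-free modules\<close>

definition non_zero_divisors :: "('a, 'c) ring_scheme \<Rightarrow> 'a set"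
  where "non_zero_divisors R =
    {r \<in> carrier R. \<forall>x\<in>carrier R. r \<otimes>\<^bsub>R\<^esub> x = \<zero>\<^bsub>R\<^esub> \<longrightarrow> x = \<zero>\<^bsub>R\<^esub>}"

definition torsion_free :: "('a, 'c) ring_scheme \<Rightarrow> ('a, 'b, 'd) module_scheme \<Rightarrow> bool"
  where "torsion_free R M \<longleftrightarrow>
    (\<forall>r\<in>non_zero_divisors R. inj_on (\<lambda>x. r \<odot>\<^bsub>M\<^esub> x) (carrier M))"

definition simple_torsion_free :: "('a, 'c) ring_scheme \<Rightarrow> ('a, 'b, 'd) module_scheme \<Rightarrow> bool"
  where "simple_torsion_free R M \<longleftrightarrow>
    torsion_free R M \<and> carrier M \<noteq> {\<zero>\<^bsub>M\<^esub>} \<and>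
    (\<forall>U. submodule U R M \<and> U \<noteq> {\<zero>\<^bsub>M\<^esub>} \<and> U \<subset> carrier M \<longrightarrow>
      \<not> torsion_free R (quot_module R M U))"


section \<open>Localization and residue fields\<close>

definition loc_rel :: "('a, 'c) ring_scheme \<Rightarrow> 'a set \<Rightarrow> (('a \<times> 'a) \<times> ('a \<times> 'a)) set"
  where "loc_rel R S =
    {((a, s), (b, t)). a \<in> carrier R \<and> s \<in> S \<and> b \<in> carrier R \<and> t \<in> S \<and>
      (\<exists>u\<in>S. u \<otimes>\<^bsub>R\<^esub> (a \<otimes>\<^bsub>R\<^esub> t \<ominus>\<^bsub>R\<^esub> b \<otimes>\<^bsub>R\<^esub> s) = \<zero>\<^bsub>R\<^esub>)}"

definition loc_frac :: "('a, 'c) ring_scheme \<Rightarrow> 'a set \<Rightarrow> 'a \<Rightarrow> 'a \<Rightarrow> ('a \<times> 'a) set"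
  where "loc_frac R S a s = loc_rel R S `` {(a, s)}"

text \<open>
  As with \<^const>\<open>rcoset_mult\<close>, operations on classes are unions over representatives; all members
  of such a union coincide.
\<close>

definition localization :: "('a, 'c) ring_scheme \<Rightarrow> 'a set \<Rightarrow> ('a \<times> 'a) set ring"
  where "localization R S =
    \<lparr>carrier = (carrier R \<times> S) // loc_rel R S,
     monoid.mult = (\<lambda>X Y. \<Union>(a, s)\<in>X. \<Union>(b, t)\<in>Y. loc_frac R S (a \<otimes>\<^bsub>R\<^esub> b) (s \<otimes>\<^bsub>R\<^esub> t)),
     one = loc_frac R S \<one>\<^bsub>R\<^esub> \<one>\<^bsub>R\<^esub>,
     zero = loc_frac R S \<zero>\<^bsub>R\<^esub> \<one>\<^bsub>R\<^esub>,
     add = (\<lambda>X Y. \<Union>(a, s)\<in>X. \<Union>(b, t)\<in>Y.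
       loc_frac R S ((a \<otimes>\<^bsub>R\<^esub> t) \<oplus>\<^bsub>R\<^esub> (b \<otimes>\<^bsub>R\<^esub> s)) (s \<otimes>\<^bsub>R\<^esub> t))\<rparr>"

definition localization_at :: "('a, 'c) ring_scheme \<Rightarrow> 'a set \<Rightarrow> ('a \<times> 'a) set ring"
  where "localization_at R \<pp> = localization R (carrier R - \<pp>)"

definition localization_map :: "('a, 'c) ring_scheme \<Rightarrow> 'a set \<Rightarrow> 'a \<Rightarrow> ('a \<times> 'a) set"
  where "localization_map R \<pp> r = loc_frac R (carrier R - \<pp>) r \<one>\<^bsub>R\<^esub>"

text \<open>The extended ideal \<open>\<pp>R\<^sub>\<pp>\<close>.\<close>

definition extended_ideal :: "('a, 'c) ring_scheme \<Rightarrow> 'a set \<Rightarrow> ('a \<times> 'a) set set"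
  where "extended_ideal R \<pp> = Idl\<^bsub>localization_at R \<pp>\<^esub> (localization_map R \<pp> ` \<pp>)"

definition residue_field :: "('a, 'c) ring_scheme \<Rightarrow> 'a set \<Rightarrow> ('a \<times> 'a) set set ring"
  where "residue_field R \<pp> = localization_at R \<pp> Quot extended_ideal R \<pp>"

text \<open>\<open>\<kappa>(\<pp>)\<close> as an \<open>R\<close>-module, along \<open>R \<rightarrow> R\<^sub>\<pp> \<rightarrow> R\<^sub>\<pp>/\<pp>R\<^sub>\<pp>\<close>.\<close>

definition residue_module :: "('a, 'c) ring_scheme \<Rightarrow> 'a set \<Rightarrow> ('a, ('a \<times> 'a) set set) module"
  where "residue_module R \<pp> =
    \<lparr>carrier = carrier (residue_field R \<pp>),
     monoid.mult = monoid.mult (residue_field R \<pp>),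
     one = one (residue_field R \<pp>),
     zero = zero (residue_field R \<pp>),
     add = add (residue_field R \<pp>),
     smult = (\<lambda>r X.
       (extended_ideal R \<pp> +>\<^bsub>localization_at R \<pp>\<^esub> localization_map R \<pp> r) \<otimes>\<^bsub>residue_field R \<pp>\<^esub> X)\<rparr>"


section \<open>Well-definedness\<close>


lemma self_module_is_module: assumes "cring R" shows "Module.module R (self_module R)"
proof -
  interpret cring R by fact
  have "abelian_group (self_module R)"
    by (intro abelian_groupI) (auto simp: self_module_def  a_ac intro!: bexI[of _ "\<ominus>\<^bsub>R\<^esub> _"] l_neg)
  then show ?thesis
    by (rule moduleI[OF is_cring])
       (auto simp: self_module_def l_distr r_distr m_assoc)
qed

lemma abelian_subgroup_if_submodule:
  assumes "Module.module R M" "submodule U R M"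
  shows "abelian_subgroup U M"
proof -
  interpret M: Module.module R M by fact
  interpret S: submodule U R M by fact
  show ?thesis
    by (rule abelian_subgroupI3)
       (auto intro: additive_subgroup.intro S.subgroup_axioms M.M.abelian_group_axioms)
qed

lemma quot_module_smult:
  assumes "Module.module R M" "submodule U R M" "r \<in> carrier R" "x \<in> carrier M"
  shows "r \<odot>\<^bsub>quot_module R M U\<^esub> (U +>\<^bsub>M\<^esub> x) = U +>\<^bsub>M\<^esub> (r \<odot>\<^bsub>M\<^esub> x)"
proof -
  interpret M: Module.module R M by fact
  interpret S: submodule U R M by fact
  interpret A: abelian_subgroup U M
    by (rule abelian_subgroup_if_submodule) fact+
  have *: "U +>\<^bsub>M\<^esub> (r \<odot>\<^bsub>M\<^esub> y) = U +>\<^bsub>M\<^esub> (r \<odot>\<^bsub>M\<^esub> x)" if y: "y \<in> U +>\<^bsub>M\<^esub> x" for y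
  proof -
    from y obtain u where u: "u \<in> U" "y = u \<oplus>\<^bsub>M\<^esub> x" by (auto simp: a_r_coset_def')
    then have "r \<odot>\<^bsub>M\<^esub> y = r \<odot>\<^bsub>M\<^esub> u \<oplus>\<^bsub>M\<^esub> r \<odot>\<^bsub>M\<^esub> x"
      using assms A.a_Hcarr by (simp add: M.smult_r_distr)
    moreover have "r \<odot>\<^bsub>M\<^esub> u \<in> U" using u assms by simp
    ultimately have "r \<odot>\<^bsub>M\<^esub> y \<in> U +>\<^bsub>M\<^esub> (r \<odot>\<^bsub>M\<^esub> x)" by (auto simp: a_r_coset_def')
    then show ?thesis using assms A.a_repr_independence'[of _ "r \<odot>\<^bsub>M\<^esub> x"] by auto
  qed
  have "x \<in> U +>\<^bsub>M\<^esub> x" using A.a_rcos_self assms by simp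
  then have "(\<Union>y\<in>U +>\<^bsub>M\<^esub> x. U +>\<^bsub>M\<^esub> (r \<odot>\<^bsub>M\<^esub> y)) = U +>\<^bsub>M\<^esub> (r \<odot>\<^bsub>M\<^esub> x)"
    using * by blast
  then show ?thesis by (simp add: quot_module_def)
qed

lemma quot_module_is_module:
  assumes "Module.module R M" "submodule U R M"
  shows "Module.module R (quot_module R M U)" (is "Module.module R ?Q")
proof -
  interpret M: Module.module R M by fact
  interpret A: abelian_subgroup U M
    by (rule abelian_subgroup_if_submodule) fact+
  have car: "carrier ?Q = (\<lambda>x. U +>\<^bsub>M\<^esub> x) ` carrier M"
    by (auto simp: quot_module_def A_RCOSETS_def' )
  have add: "(U +>\<^bsub>M\<^esub> x) \<oplus>\<^bsub>?Q\<^esub> (U +>\<^bsub>M\<^esub> y) = U +>\<^bsub>M\<^esub> (x \<oplus>\<^bsub>M\<^esub> y)"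
    if "x \<in> carrier M" "y \<in> carrier M" for x y
    using A.a_rcos_sum[OF that] by (simp add: quot_module_def)
  have zero: "\<zero>\<^bsub>?Q\<^esub> = U +>\<^bsub>M\<^esub> \<zero>\<^bsub>M\<^esub>"
    using A.a_subset by (simp add: quot_module_def)
  have "abelian_group ?Q"
  proof (rule abelian_groupI)
    fix x assume "x \<in> carrier ?Q"
    then obtain m where "m \<in> carrier M" "x = U +>\<^bsub>M\<^esub> m" by (auto simp: car)
    then show "\<exists>y\<in>carrier ?Q. y \<oplus>\<^bsub>?Q\<^esub> x = \<zero>\<^bsub>?Q\<^esub>"
      using add[of "\<ominus>\<^bsub>M\<^esub> m" m] zero M.M.l_neg[of m] M.M.a_inv_closed[of m] unfolding car by auto
  next
    fix x y assume "x \<in> carrier ?Q" "y \<in> carrier ?Q"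
    then show "x \<oplus>\<^bsub>?Q\<^esub> y \<in> carrier ?Q" "x \<oplus>\<^bsub>?Q\<^esub> y = y \<oplus>\<^bsub>?Q\<^esub> x"
      by (auto simp: car add M.M.a_comm)
  next
    show "\<zero>\<^bsub>?Q\<^esub> \<in> carrier ?Q" unfolding car zero by blast
  next
    fix x assume "x \<in> carrier ?Q"
    then obtain m where "m \<in> carrier M" "x = U +>\<^bsub>M\<^esub> m" by (auto simp: car)
    then show "\<zero>\<^bsub>?Q\<^esub> \<oplus>\<^bsub>?Q\<^esub> x = x" using add[of "\<zero>\<^bsub>M\<^esub>" m] zero by simp
  next
    fix x y z assume "x \<in> carrier ?Q" "y \<in> carrier ?Q" "z \<in> carrier ?Q"
    then show "x \<oplus>\<^bsub>?Q\<^esub> y \<oplus>\<^bsub>?Q\<^esub> z = x \<oplus>\<^bsub>?Q\<^esub> (y \<oplus>\<^bsub>?Q\<^esub> z)"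
      by (auto simp: car add M.M.a_assoc)
  qed
  then show ?thesis
    by (rule moduleI[OF M.R.is_cring])
       (auto simp: car add quot_module_smult[OF assms] M.smult_l_distr M.smult_r_distr M.smult_assoc1)
qed

locale mult_subset = cring R for R (structure) +
  fixes S
  assumes S_carrier: "S \<subseteq> carrier R" and one_S: "\<one> \<in> S"
    and mult_S: "s \<in> S \<Longrightarrow> t \<in> S \<Longrightarrow> s \<otimes> t \<in> S"
begin

abbreviation "fr \<equiv> loc_frac R S"
abbreviation "L \<equiv> localization R S"

lemma S_c[simp, intro]: "s \<in> S \<Longrightarrow> s \<in> carrier R" using S_carrier by auto
declare one_S[simp,intro] mult_S[simp,intro]

lemma loc_rel_iff: "((a, s), (b, t)) \<in> loc_rel R S \<longleftrightarrow> a \<in> carrier R \<and> s \<in> S \<and> b \<in> carrier R \<and> t \<in> S \<and>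
      (\<exists>u\<in>S. u \<otimes> (a \<otimes> t) = u \<otimes> (b \<otimes> s))"
proof -
  have "u \<otimes> (a \<otimes> t \<ominus> b \<otimes> s) = \<zero> \<longleftrightarrow> u \<otimes> (a \<otimes> t) = u \<otimes> (b \<otimes> s)"
    if "a \<in> carrier R" "s \<in> S" "b \<in> carrier R" "t \<in> S" "u \<in> S" for u
  proof -
    have "u \<otimes> (a \<otimes> t \<ominus> b \<otimes> s) = u \<otimes> (a \<otimes> t) \<ominus> u \<otimes> (b \<otimes> s)"
      using that by (simp add: minus_eq r_distr r_minus)
    then show ?thesis using that by simp
  qed
  then show ?thesis unfolding loc_rel_def by blast
qed

lemma equiv_loc_rel: "equiv (carrier R \<times> S) (loc_rel R S)"
proof (rule equivI)
  show "refl_on (carrier R \<times> S) (loc_rel R S)"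
    by (auto simp: refl_on_def loc_rel_iff)
  show "sym (loc_rel R S)"
    by (auto simp: sym_def loc_rel_iff intro: sym)
  show "loc_rel R S \<subseteq> (carrier R \<times> S) \<times> (carrier R \<times> S)"
    by (auto simp: loc_rel_def)
  show "trans (loc_rel R S)"
  proof (rule transI, clarify)
    fix a s b t c v
    assume "((a, s), (b, t)) \<in> loc_rel R S" "((b, t), (c, v)) \<in> loc_rel R S"
    then obtain x y where m: "a \<in> carrier R" "s \<in> S" "b \<in> carrier R" "t \<in> S" "c \<in> carrier R" "v \<in> S"
       "x \<in> S" "y \<in> S" and 1: "x \<otimes> (a \<otimes> t) = x \<otimes> (b \<otimes> s)" and 2: "y \<otimes> (b \<otimes> v) = y \<otimes> (c \<otimes> t)"
      by (auto simp: loc_rel_iff)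
    have c: "x \<in> carrier R" "y \<in> carrier R" "s \<in> carrier R" "t \<in> carrier R" "v \<in> carrier R" using m by auto
    have "(x \<otimes> y \<otimes> t) \<otimes> (a \<otimes> v) = y \<otimes> v \<otimes> (x \<otimes> (a \<otimes> t))" using m c by (simp add: m_ac)
    also have "\<dots> = x \<otimes> s \<otimes> (y \<otimes> (b \<otimes> v))" unfolding 1 using m c by (simp add: m_ac)
    also have "\<dots> = (x \<otimes> y \<otimes> t) \<otimes> (c \<otimes> s)" unfolding 2 using m c by (simp add: m_ac)
    finally show "((a, s), (c, v)) \<in> loc_rel R S" using m by (auto simp: loc_rel_iff)
  qed
qed

lemma fr_eq: "a \<in> carrier R \<Longrightarrow> s \<in> S \<Longrightarrow> b \<in> carrier R \<Longrightarrow> t \<in> S \<Longrightarrow>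
  fr a s = fr b t \<longleftrightarrow> (\<exists>u\<in>S. u \<otimes> (a \<otimes> t) = u \<otimes> (b \<otimes> s))"
  unfolding loc_frac_def by (subst eq_equiv_class_iff[OF equiv_loc_rel]) (auto simp: loc_rel_iff)

lemma self_fr: "a \<in> carrier R \<Longrightarrow> s \<in> S \<Longrightarrow> (a,s) \<in> fr a s"
  by (auto simp: loc_frac_def loc_rel_iff)

lemma in_fr: "(b,t) \<in> fr a s \<longleftrightarrow> a \<in> carrier R \<and> s \<in> S \<and> b \<in> carrier R \<and> t \<in> S \<and>
      (\<exists>u\<in>S. u \<otimes> (a \<otimes> t) = u \<otimes> (b \<otimes> s))"
  by (auto simp: loc_frac_def loc_rel_iff)

lemma loc_mult:
  assumes "a \<in> carrier R" "s \<in> S" "b \<in> carrier R" "t \<in> S"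
  shows "fr a s \<otimes>\<^bsub>L\<^esub> fr b t = fr (a \<otimes> b) (s \<otimes> t)"
proof -
  have "fr (a' \<otimes> b') (s' \<otimes> t') = fr (a \<otimes> b) (s \<otimes> t)" 
    if h: "(a', s') \<in> fr a s" "(b', t') \<in> fr b t" for a' s' b' t'
  proof -
    from h obtain x y where m: "a' \<in> carrier R" "s' \<in> S" "b' \<in> carrier R" "t' \<in> S"
       "x \<in> S" "y \<in> S" and 1: "x \<otimes> (a \<otimes> s') = x \<otimes> (a' \<otimes> s)" and 2: "y \<otimes> (b \<otimes> t') = y \<otimes> (b' \<otimes> t)"
      by (auto simp: in_fr)
    have c: "x \<in> carrier R" "y \<in> carrier R" "s \<in> carrier R" "t \<in> carrier R" "s' \<in> carrier R" "t' \<in> carrier R"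
      using m assms by auto
    have "x \<otimes> y \<otimes> ((a' \<otimes> b') \<otimes> (s \<otimes> t)) = (x \<otimes> (a' \<otimes> s)) \<otimes> (y \<otimes> (b' \<otimes> t))"
      using m c by (simp add: m_ac)
    also have "\<dots> = x \<otimes> y \<otimes> ((a \<otimes> b) \<otimes> (s' \<otimes> t'))" unfolding 1[symmetric] 2[symmetric]
      using m c assms by (simp add: m_ac)
    finally show ?thesis using m assms by (subst fr_eq) auto
  qed
  then have "(\<Union>(a', s')\<in>fr a s. \<Union>(b', t')\<in>fr b t. fr (a' \<otimes> b') (s' \<otimes> t')) = fr (a \<otimes> b) (s \<otimes> t)"
    using self_fr[of a s] self_fr[of b t] assms by blast
  then show ?thesis by (simp add: localization_def)
qed

lemma loc_add:
  assumes "a \<in> carrier R" "s \<in> S" "b \<in> carrier R" "t \<in> S"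
  shows "fr a s \<oplus>\<^bsub>L\<^esub> fr b t = fr (a \<otimes> t \<oplus> b \<otimes> s) (s \<otimes> t)"
proof -
  have "fr (a' \<otimes> t' \<oplus> b' \<otimes> s') (s' \<otimes> t') = fr (a \<otimes> t \<oplus> b \<otimes> s) (s \<otimes> t)" 
    if h: "(a', s') \<in> fr a s" "(b', t') \<in> fr b t" for a' s' b' t'
  proof -
    from h obtain x y where m: "a' \<in> carrier R" "s' \<in> S" "b' \<in> carrier R" "t' \<in> S"
       "x \<in> S" "y \<in> S" and 1: "x \<otimes> (a \<otimes> s') = x \<otimes> (a' \<otimes> s)" and 2: "y \<otimes> (b \<otimes> t') = y \<otimes> (b' \<otimes> t)"
      by (auto simp: in_fr)
    have c: "x \<in> carrier R" "y \<in> carrier R" "s \<in> carrier R" "t \<in> carrier R" "s' \<in> carrier R" "t' \<in> carrier R"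
      using m assms by auto
    have "x \<otimes> y \<otimes> ((a' \<otimes> t' \<oplus> b' \<otimes> s') \<otimes> (s \<otimes> t)) 
      = (x \<otimes> (a' \<otimes> s)) \<otimes> (y \<otimes> t' \<otimes> t) \<oplus> (y \<otimes> (b' \<otimes> t)) \<otimes> (x \<otimes> s' \<otimes> s)"
      using m c by (simp add: m_ac l_distr r_distr)
    also have "\<dots> = x \<otimes> y \<otimes> ((a \<otimes> t \<oplus> b \<otimes> s) \<otimes> (s' \<otimes> t'))" unfolding 1[symmetric] 2[symmetric]
      using m c assms by (simp add: m_ac l_distr r_distr)
    finally show ?thesis using m assms by (subst fr_eq) auto
  qed
  then have "(\<Union>(a', s')\<in>fr a s. \<Union>(b', t')\<in>fr b t. fr (a' \<otimes> t' \<oplus> b' \<otimes> s') (s' \<otimes> t')) = fr (a \<otimes> t \<oplus> b \<otimes> s) (s \<otimes> t)"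
    using self_fr[of a s] self_fr[of b t] assms by blast
  then show ?thesis by (simp add: localization_def)
qed

lemma loc_carrier: "carrier L = {fr a s | a s. a \<in> carrier R \<and> s \<in> S}"
  by (auto simp: localization_def quotient_def loc_frac_def)

lemma loc_one: "\<one>\<^bsub>L\<^esub> = fr \<one> \<one>" and loc_zero: "\<zero>\<^bsub>L\<^esub> = fr \<zero> \<one>"
  by (auto simp: localization_def)

lemma fr_eqI: "a \<in> carrier R \<Longrightarrow> s \<in> S \<Longrightarrow> b \<in> carrier R \<Longrightarrow> t \<in> S \<Longrightarrow> a \<otimes> t = b \<otimes> s \<Longrightarrow> fr a s = fr b t"
  by (auto simp: fr_eq)

lemma loc_cring: "cring L"
proof -
  have n: "fr (\<ominus> a) s \<oplus>\<^bsub>L\<^esub> fr a s = \<zero>\<^bsub>L\<^esub>" if "a \<in> carrier R" "s \<in> S" for a s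
    unfolding loc_zero using that by (simp add: loc_add l_minus l_neg) (rule fr_eqI; simp)
  have E: "x \<in> carrier L \<Longrightarrow> \<exists>a s. x = fr a s \<and> a \<in> carrier R \<and> s \<in> S" for x
    by (auto simp: loc_carrier)
  have I: "fr a s \<in> carrier L" if "a \<in> carrier R" "s \<in> S" for a s using that by (auto simp: loc_carrier)
  have ag: "abelian_group L"
  proof (rule abelian_groupI)
    fix x y assume "x \<in> carrier L" "y \<in> carrier L"
    then show "x \<oplus>\<^bsub>L\<^esub> y \<in> carrier L" "x \<oplus>\<^bsub>L\<^esub> y = y \<oplus>\<^bsub>L\<^esub> x"
      by (auto dest!: E simp: loc_add I m_ac a_ac)
  next
    show "\<zero>\<^bsub>L\<^esub> \<in> carrier L" by (simp add: loc_zero I)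
  next
    fix x assume "x \<in> carrier L"
    then obtain a s where x: "x = fr a s" "a \<in> carrier R" "s \<in> S" using E by blast
    show "\<zero>\<^bsub>L\<^esub> \<oplus>\<^bsub>L\<^esub> x = x" using x by (simp add: loc_zero loc_add)
    show "\<exists>y\<in>carrier L. y \<oplus>\<^bsub>L\<^esub> x = \<zero>\<^bsub>L\<^esub>" unfolding x(1)
      using n[OF x(2,3)] I[of "\<ominus> a" s] x(2,3) by auto
  next
    fix x y z assume "x \<in> carrier L" "y \<in> carrier L" "z \<in> carrier L"
    then show "x \<oplus>\<^bsub>L\<^esub> y \<oplus>\<^bsub>L\<^esub> z = x \<oplus>\<^bsub>L\<^esub> (y \<oplus>\<^bsub>L\<^esub> z)"
      by (auto dest!: E simp: loc_add l_distr r_distr m_ac a_ac)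
  qed
  have cm: "Group.comm_monoid L"
  proof (rule comm_monoidI)
    show "\<one>\<^bsub>L\<^esub> \<in> carrier L" by (simp add: loc_one I)
  qed (auto dest!: E simp: loc_mult loc_one I m_ac)
  show ?thesis
  proof (rule cringI[OF ag cm])
    fix x y z assume "x \<in> carrier L" "y \<in> carrier L" "z \<in> carrier L"
    then obtain a s b t c u where x: "x = fr a s" "a \<in> carrier R" "s \<in> S"
      "y = fr b t" "b \<in> carrier R" "t \<in> S" "z = fr c u" "c \<in> carrier R" "u \<in> S"
      using E by metis
    show "(x \<oplus>\<^bsub>L\<^esub> y) \<otimes>\<^bsub>L\<^esub> z = x \<otimes>\<^bsub>L\<^esub> z \<oplus>\<^bsub>L\<^esub> y \<otimes>\<^bsub>L\<^esub> z"
      unfolding x using x(2,3,5,6,8,9)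
      by (simp add: loc_add loc_mult) (rule fr_eqI; simp add: l_distr r_distr m_ac)
  qed
qed

lemma loc_hom: "(\<lambda>r. fr r \<one>) \<in> ring_hom R L"
proof (rule ring_hom_memI)
  fix x assume "x \<in> carrier R"
  then show "fr x \<one> \<in> carrier L" unfolding loc_carrier using one_S by blast
qed (simp_all add: loc_mult loc_add loc_one)

end

lemma mult_subset_prime: assumes "primeideal \<pp> R" shows "mult_subset R (carrier R - \<pp>)"
proof -
  interpret primeideal \<pp> R by fact
  show ?thesis using I_prime one_imp_carrier I_notcarr by unfold_locales auto
qed

lemma residue_module_is_module:
  assumes "primeideal \<pp> R" shows "Module.module R (residue_module R \<pp>)"
proof -
  interpret primeideal \<pp> R by fact
  interpret mult_subset R "carrier R - \<pp>" by (rule mult_subset_prime) fact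
  let ?L = "localization_at R \<pp>" and ?I = "extended_ideal R \<pp>"
  let ?K = "residue_field R \<pp>"
  interpret L: cring ?L unfolding localization_at_def by (rule loc_cring)
  have lm: "localization_map R \<pp> \<in> ring_hom R ?L"
    using loc_hom by (simp add: localization_map_def[abs_def] localization_at_def)
  have "localization_map R \<pp> ` \<pp> \<subseteq> carrier ?L" using lm a_subset by (auto simp: ring_hom_def)
  then interpret I: ideal ?I ?L unfolding extended_ideal_def by (rule L.genideal_ideal)
  interpret K: cring ?K unfolding residue_field_def by (rule I.quotient_is_cring) (rule L.is_cring)
  define g where "g = (\<lambda>r. ?I +>\<^bsub>?L\<^esub> localization_map R \<pp> r)"
  have "g \<in> ring_hom R ?K"
    using ring_hom_trans[OF lm I.rcos_ring_hom] by (simp add: g_def residue_field_def o_def)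
  then interpret g: ring_hom_ring R ?K g by (intro ring_hom_ringI2 K.ring_axioms ring_axioms)
  have s: "r \<odot>\<^bsub>residue_module R \<pp>\<^esub> X = g r \<otimes>\<^bsub>?K\<^esub> X" for r X by (simp add: residue_module_def g_def)
  have "abelian_group (residue_module R \<pp>)"
    by (intro abelian_groupI) (auto simp: residue_module_def K.a_ac intro!: bexI[of _ "\<ominus>\<^bsub>?K\<^esub> _"] K.l_neg)
  then show ?thesis
    by (rule moduleI[OF is_cring]; simp only: s)
       (auto simp: residue_module_def K.l_distr K.r_distr K.m_assoc)
qed

end

theory Submission
  imports Defs
begin

text \<open>
  Both sides of the equivalence say that \<open>M\<close> is uniform in a strong sense: any two elements of \<open>M\<close>,
  the second one nonzero, satisfy a relation \<open>t n = r m\<close>, and all nonzero elements have the "right"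
  annihilator. What differs is the set of admissible \<open>t\<close>.

  The saturation \<open>{n. t n \<in> R m for some non-zero-divisor t}\<close> of a cyclic submodule has a torsion-free
  quotient. Hence \<open>M\<close> is simple torsion-free iff no annihilator of a nonzero element contains a
  non-zero-divisor and the saturation of \<open>R m\<close> is all of \<open>M\<close> for every \<open>m \<noteq> 0\<close>
  (\<open>simple_torsion_free_iff\<close>). On the other side, \<open>\<kappa>(\<pp>)\<close> is the fraction field of \<open>R/\<pp>\<close>, and the nonzero
  modules that embed into it are the torsion-free \<open>R/\<pp>\<close>-modules of rank one: every nonzero element
  has annihilator \<open>\<pp>\<close>, and \<open>s n = r m\<close> is solvable with \<open>s \<notin> \<pp>\<close>
  (\<open>embeds_in_residue_module_iff\<close>; the embedding sends \<open>n\<close> to the fraction \<open>r/s\<close> for a fixed \<open>m\<close>).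

  The two descriptions are linked by a fact on Noetherian rings: an ideal consisting of zero divisors
  lies in a maximal element of \<open>Ass(R)\<close> (\<open>zero_divisor_ideal_subset_maximal_in_Ass\<close>). It holds because
  these maximal elements are finitely many and cover the zero divisors, so that prime avoidance
  applies. Now let \<open>M\<close> be simple torsion-free and \<open>m \<noteq> 0\<close>. Then \<open>ann(m)\<close> lies in such a \<open>\<pp>\<close>. If \<open>r \<in> \<pp>\<close>
  did not kill \<open>m\<close>, a relation \<open>t m = a r m\<close> with a non-zero-divisor \<open>t\<close> would give
  \<open>t - a r \<in> ann(m) \<subseteq> \<pp>\<close>, hence \<open>t \<in> \<pp>\<close>, which is impossible. So \<open>ann(m) = \<pp>\<close>. Conversely, let \<open>\<pp>\<close> be
  maximal in \<open>Ass(R)\<close> and \<open>M\<close> embedded in \<open>\<kappa>(\<pp>)\<close>. The ideal of all \<open>t\<close> with \<open>t n \<in> R m\<close> contains \<open>\<pp>\<close>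
  properly, so by maximality of \<open>\<pp>\<close> it cannot consist of zero divisors.
\<close>

section \<open>Ideals of zero divisors in a Noetherian ring\<close>

text \<open>Closure under negation comes for free, from multiplication by \<open>-1\<close>.\<close>

lemma (in cring) ideal_if_closed:
  assumes "J \<subseteq> carrier R" "\<zero> \<in> J"
    and "\<And>a b. a \<in> J \<Longrightarrow> b \<in> J \<Longrightarrow> a \<oplus> b \<in> J"
    and mult: "\<And>r a. r \<in> carrier R \<Longrightarrow> a \<in> J \<Longrightarrow> r \<otimes> a \<in> J"
  shows "ideal J R"
proof (rule idealI[OF ring_axioms])
  show "subgroup J (add_monoid R)"
  proof (rule group.subgroupI)
    show "group (add_monoid R)" by (rule a_group)
    show "inv\<^bsub>add_monoid R\<^esub> a \<in> J" if "a \<in> J" for a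
    proof -
      have "\<ominus> a = (\<ominus> \<one>) \<otimes> a" using that assms(1) by (auto simp: l_minus)
      then show ?thesis using mult[of "\<ominus> \<one>" a] that by (simp add: a_inv_def)
    qed
  qed (use assms in auto)
next
  fix a x assume a: "a \<in> J" "x \<in> carrier R"
  then show "x \<otimes> a \<in> J" using mult by blast
  then show "a \<otimes> x \<in> J" using a assms(1) m_comm[of a x] by auto
qed

lemma (in Module.module) annihilator_ideal:
  assumes "x \<in> carrier M"
  shows "ideal (annihilator R M x) R"
proof (rule R.ideal_if_closed)
  show "annihilator R M x \<subseteq> carrier R" by (auto simp: annihilator_def)
  show "\<zero>\<^bsub>R\<^esub> \<in> annihilator R M x" using assms by (simp add: annihilator_def)
  show "a \<oplus>\<^bsub>R\<^esub> b \<in> annihilator R M x" if "a \<in> annihilator R M x" "b \<in> annihilator R M x" for a b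
    using that assms by (simp add: annihilator_def smult_l_distr)
  show "r \<otimes>\<^bsub>R\<^esub> a \<in> annihilator R M x" if "r \<in> carrier R" "a \<in> annihilator R M x" for r a
    using that assms by (simp add: annihilator_def smult_assoc1)
qed

lemma (in noetherian_ring) maximal_ideal_in_family:
  assumes "F \<noteq> {}" "\<And>I. I \<in> F \<Longrightarrow> ideal I R"
  shows "\<exists>I\<in>F. \<forall>J\<in>F. I \<subseteq> J \<longrightarrow> J = I"
proof (rule subset_Zorn)
  fix C assume C: "subset.chain F C"
  show "\<exists>U\<in>F. \<forall>X\<in>C. X \<subseteq> U"
  proof (cases "C = {}")
    case False
    have "subset.chain {I. ideal I R} C" using C assms(2) by (auto simp: pred_on.chain_def)
    then have "\<Union>C \<in> C" using ideal_chain_is_trivial False by blast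
    then show ?thesis using C by (auto simp: pred_on.chain_def)
  qed (use assms in auto)
qed

text \<open>
  A maximal one among the annihilators of nonzero elements is prime: if \<open>a b\<close> kills \<open>y\<close> and \<open>b\<close> does not,
  then \<open>ann(b y) \<supseteq> ann(y)\<close> is again such an annihilator, so that it equals \<open>ann(y)\<close> and contains \<open>a\<close>.
\<close>

lemma annihilator_subset_maximal_in_Ass:
  assumes "noetherian_ring R" "Module.module R M" "x \<in> carrier M" "x \<noteq> \<zero>\<^bsub>M\<^esub>"
  shows "\<exists>P. maximal_in P (Ass R M) \<and> annihilator R M x \<subseteq> P"
proof -
  interpret N: noetherian_ring R by fact
  interpret Module.module R M by fact
  let ?ann = "annihilator R M"
  define F where "F = {?ann y | y. y \<in> carrier M \<and> y \<noteq> \<zero>\<^bsub>M\<^esub> \<and> ?ann x \<subseteq> ?ann y}"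
  have "F \<noteq> {}" using assms by (auto simp: F_def)
  moreover have "ideal I R" if "I \<in> F" for I using that annihilator_ideal by (auto simp: F_def)
  ultimately obtain P where P: "P \<in> F" and max: "\<And>J. J \<in> F \<Longrightarrow> P \<subseteq> J \<Longrightarrow> J = P"
    using N.maximal_ideal_in_family by metis
  then obtain y where y: "y \<in> carrier M" "y \<noteq> \<zero>\<^bsub>M\<^esub>" "?ann x \<subseteq> ?ann y" and Py: "P = ?ann y"
    by (auto simp: F_def)
  have "primeideal P R"
  proof (rule primeidealI)
    show "ideal P R" unfolding Py using y by (simp add: annihilator_ideal)
    show "cring R" by (rule R.is_cring)
    have "\<one>\<^bsub>R\<^esub> \<notin> P" using y by (simp add: Py annihilator_def)
    then show "carrier R \<noteq> P" by auto
    fix a b assume ab: "a \<in> carrier R" "b \<in> carrier R" "a \<otimes>\<^bsub>R\<^esub> b \<in> P"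
    show "a \<in> P \<or> b \<in> P"
    proof (rule disjCI)
      assume "b \<notin> P"
      then have nz: "b \<odot>\<^bsub>M\<^esub> y \<noteq> \<zero>\<^bsub>M\<^esub>" using ab by (simp add: Py annihilator_def)
      have "c \<in> ?ann (b \<odot>\<^bsub>M\<^esub> y)" if c: "c \<in> P" for c
      proof -
        have cc: "c \<in> carrier R" "c \<odot>\<^bsub>M\<^esub> y = \<zero>\<^bsub>M\<^esub>" using c by (auto simp: Py annihilator_def)
        have "c \<odot>\<^bsub>M\<^esub> (b \<odot>\<^bsub>M\<^esub> y) = (b \<otimes>\<^bsub>R\<^esub> c) \<odot>\<^bsub>M\<^esub> y"
          using cc ab y by (simp add: smult_assoc1[symmetric] R.m_comm)
        then show ?thesis using cc ab y by (simp add: annihilator_def smult_assoc1)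
      qed
      then have sub: "P \<subseteq> ?ann (b \<odot>\<^bsub>M\<^esub> y)" by blast
      then have "?ann (b \<odot>\<^bsub>M\<^esub> y) \<in> F" using nz ab y Py by (auto simp: F_def)
      then have "?ann (b \<odot>\<^bsub>M\<^esub> y) = P" using max sub by blast
      moreover have "a \<in> ?ann (b \<odot>\<^bsub>M\<^esub> y)"
        using ab y by (simp add: Py annihilator_def smult_assoc1)
      ultimately show "a \<in> P" by simp
    qed
  qed
  moreover have "Q = P" if Q: "Q \<in> Ass R M" "P \<subseteq> Q" for Q
  proof -
    obtain z where z: "z \<in> carrier M" "Q = ?ann z" "primeideal Q R" using Q by (auto simp: Ass_def)
    then have "z \<noteq> \<zero>\<^bsub>M\<^esub>" using primeideal.I_notcarr[OF z(3)] by (auto simp: annihilator_def)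
    then have "Q \<in> F" using z Q y Py by (auto simp: F_def)
    then show ?thesis using max Q by blast
  qed
  ultimately have "maximal_in P (Ass R M)" using y Py by (auto simp: maximal_in_def Ass_def)
  then show ?thesis using y Py by blast
qed

text \<open>
  The intersection with the carrier gives the empty family the intersection \<open>R\<close>, which no prime
  contains.
\<close>

lemma (in primeideal) finite_Inter_subset_prime:
  assumes "finite F" "\<And>J. J \<in> F \<Longrightarrow> ideal J R" "carrier R \<inter> \<Inter>F \<subseteq> I"
  shows "\<exists>J\<in>F. J \<subseteq> I"
proof (rule ccontr)
  assume contra: "\<not> (\<exists>J\<in>F. J \<subseteq> I)"
  have "\<exists>a\<in>carrier R. a \<in> \<Inter>F \<and> a \<notin> I"
    using assms(1) assms(2) contra
  proof (induction F)
    case empty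
    then show ?case using I_notcarr a_subset by auto
  next
    case (insert J F)
    then obtain a where a: "a \<in> carrier R" "a \<in> \<Inter>F" "a \<notin> I" by auto
    obtain b where b: "b \<in> J" "b \<notin> I" using insert.prems by auto
    interpret J: ideal J R using insert.prems by auto
    have bc: "b \<in> carrier R" using b by auto
    have "b \<otimes> a \<in> K" if "K \<in> insert J F" for K
    proof -
      interpret K: ideal K R using insert.prems that by auto
      show ?thesis using that a b bc J.I_r_closed K.I_l_closed by auto
    qed
    moreover have "b \<otimes> a \<notin> I" using a b bc I_prime by blast
    ultimately show ?case using a bc by auto
  qed
  then show False using assms by auto
qed

text \<open>
  Primes contained in another member can be dropped, so let the members be incomparable. If \<open>J\<close> lies in
  none of them, choose by induction \<open>x \<in> J\<close> outside all members but \<open>P\<close>, and \<open>y\<close> in \<open>J\<close> and in all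
  members but \<open>P\<close>; then \<open>x + y\<close> avoids every member.
\<close>

lemma (in cring) prime_avoidance:
  assumes "ideal J R" "finite F" "\<And>P. P \<in> F \<Longrightarrow> primeideal P R" "J \<subseteq> \<Union>F"
  shows "\<exists>P\<in>F. J \<subseteq> P"
  using assms(2-4)
proof (induction F rule: finite_psubset_induct)
  case (psubset F)
  interpret J: ideal J R by fact
  show ?case
  proof (cases "\<exists>P\<in>F. \<exists>Q\<in>F. Q \<noteq> P \<and> Q \<subseteq> P")
    case True
    then obtain P Q where PQ: "P \<in> F" "Q \<in> F" "Q \<noteq> P" "Q \<subseteq> P" by blast
    then have "\<Union>(F - {Q}) = \<Union>F" by blast
    then have "\<exists>P\<in>F - {Q}. J \<subseteq> P" using PQ psubset.prems by (intro psubset.IH) auto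
    then show ?thesis by blast
  next
    case antichain: False
    show ?thesis
    proof (rule ccontr)
      assume contra: "\<not> (\<exists>P\<in>F. J \<subseteq> P)"
      obtain P where P: "P \<in> F" using psubset.prems(2) J.zero_closed by blast
      interpret P: primeideal P R using psubset.prems P by auto
      have "\<not> J \<subseteq> \<Union>(F - {P})" using psubset.IH[of "F - {P}"] P psubset.prems(1) contra by blast
      then obtain x where x: "x \<in> J" "x \<notin> \<Union>(F - {P})" by auto
      then have xP: "x \<in> P" using psubset.prems(2) by auto
      have "\<not> (\<exists>Q\<in>insert J (F - {P}). Q \<subseteq> P)" using antichain contra P by blast
      then have "\<not> carrier R \<inter> \<Inter>(insert J (F - {P})) \<subseteq> P"
        using P.finite_Inter_subset_prime[of "insert J (F - {P})"] psubset.hyps psubset.prems(1)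
          J.is_ideal by (auto dest: primeideal.axioms)
      then obtain y where y: "y \<in> carrier R" "y \<in> J" "y \<in> \<Inter>(F - {P})" "y \<notin> P" by auto
      have "x \<oplus> y \<in> J" using x y by simp
      then obtain Q where Q: "Q \<in> F" "x \<oplus> y \<in> Q" using psubset.prems(2) by auto
      interpret Q: primeideal Q R using psubset.prems Q by auto
      have xc: "x \<in> carrier R" using x by auto
      show False
      proof (cases "Q = P")
        case True
        have "y = (x \<oplus> y) \<oplus> (\<ominus> x)" using xc y by (simp add: a_comm[of x y] a_assoc r_neg)
        also have "\<dots> \<in> P" using Q(2) True P.a_inv_closed[OF xP] P.a_closed by blast
        finally show False using y by simp
      next
        case False
        then have "y \<in> Q" using y Q by auto
        have "x = (x \<oplus> y) \<oplus> (\<ominus> y)" using xc y by (simp add: a_assoc r_neg)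
        also have "\<dots> \<in> Q" using Q(2) Q.a_inv_closed[OF \<open>y \<in> Q\<close>] Q.a_closed by blast
        finally show False using x Q False by auto
      qed
    qed
  qed
qed

lemma mem_annihilator_self:
  "r \<in> annihilator R (self_module R) x \<longleftrightarrow> r \<in> carrier R \<and> r \<otimes>\<^bsub>R\<^esub> x = \<zero>\<^bsub>R\<^esub>"
  by (simp add: annihilator_def self_module_def)

lemma Ass_selfD:
  assumes "P \<in> Ass R (self_module R)"
  obtains x where "primeideal P R" "x \<in> carrier R" "x \<noteq> \<zero>\<^bsub>R\<^esub>" "P = annihilator R (self_module R) x"
proof -
  from assms obtain x where x: "primeideal P R" "x \<in> carrier R" "P = annihilator R (self_module R) x"
    by (auto simp: Ass_def self_module_def)
  interpret primeideal P R by fact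
  have "x \<noteq> \<zero>\<^bsub>R\<^esub>"
  proof
    assume "x = \<zero>\<^bsub>R\<^esub>"
    then have "r \<in> P" if "r \<in> carrier R" for r
      unfolding x(3) mem_annihilator_self using that by simp
    then have "carrier R \<subseteq> P" by blast
    then show False using I_notcarr a_subset by blast
  qed
  then show thesis using that x by blast
qed

text \<open>
  Write each maximal element \<open>P\<close> of \<open>Ass(R)\<close> as \<open>ann(x P)\<close>. By the ascending chain condition, finitely many
  of the elements \<open>x P\<close>, those with \<open>P \<in> F\<close>, generate an ideal that contains all of them. Whatever kills
  these generators kills every \<open>x Q\<close>; thus \<open>\<Inter>F \<subseteq> Q\<close>, the prime \<open>Q\<close> contains some \<open>P \<in> F\<close>, and by
  maximality of \<open>P\<close> they agree.
\<close>

lemma finite_maximal_in_Ass_self: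
  fixes R (structure)
  assumes "cring R" "noetherian_ring R"
  shows "finite {P. maximal_in P (Ass R (self_module R))}"
proof -
  interpret cring R by fact
  interpret noetherian_ring R by fact
  let ?X = "{P. maximal_in P (Ass R (self_module R))}"
  let ?ann = "annihilator R (self_module R)"
  have "\<exists>x. x \<in> carrier R \<and> P = ?ann x" if "P \<in> ?X" for P
  proof -
    have "P \<in> Ass R (self_module R)" using that by (simp add: maximal_in_def)
    then show ?thesis by (rule Ass_selfD) blast
  qed
  then obtain x where x: "\<And>P. P \<in> ?X \<Longrightarrow> x P \<in> carrier R" "\<And>P. P \<in> ?X \<Longrightarrow> P = ?ann (x P)"
    by metis
  have ideal: "ideal P R" if "P \<in> ?X" for P
    using that by (auto simp: maximal_in_def Ass_def dest: primeideal.axioms)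
  define G where "G = {Idl\<^bsub>R\<^esub> (x ` F) | F. finite F \<and> F \<subseteq> ?X}"
  have "Idl\<^bsub>R\<^esub> (x ` {}) \<in> G" unfolding G_def by blast
  then have "G \<noteq> {}" by blast
  moreover have "ideal I R" if "I \<in> G" for I
    using that x(1) unfolding G_def by (auto intro!: genideal_ideal)
  ultimately obtain I where I: "I \<in> G" and max: "\<And>J. J \<in> G \<Longrightarrow> I \<subseteq> J \<Longrightarrow> J = I"
    using maximal_ideal_in_family by metis
  then obtain F where F: "finite F" "F \<subseteq> ?X" "I = Idl\<^bsub>R\<^esub> (x ` F)" by (auto simp: G_def)
  have Fc: "x ` F \<subseteq> carrier R" using F x(1) by blast
  have "Q \<in> F" if Q: "Q \<in> ?X" for Q
  proof -
    interpret Q: primeideal Q R using Q by (auto simp: maximal_in_def Ass_def)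
    let ?J = "Idl\<^bsub>R\<^esub> (x ` insert Q F)"
    have c: "x ` insert Q F \<subseteq> carrier R" using Fc Q x(1) by blast
    have "?J \<in> G" unfolding G_def using F Q by blast
    moreover have "I \<subseteq> ?J"
      unfolding F(3) using genideal_self[OF c] by (intro genideal_minimal genideal_ideal c) auto
    ultimately have "?J = I" by (rule max)
    then have xQ: "x Q \<in> I" using genideal_self[OF c] by auto
    have "carrier R \<inter> \<Inter>F \<subseteq> Q"
    proof
      fix r assume r: "r \<in> carrier R \<inter> \<Inter>F"
      have "ideal {y \<in> carrier R. r \<otimes> y = \<zero>} R"
        by (rule ideal_if_closed) (use r in \<open>auto simp: r_distr m_lcomm\<close>)
      moreover have "x P \<in> {y \<in> carrier R. r \<otimes> y = \<zero>}" if "P \<in> F" for P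
      proof -
        have "r \<in> ?ann (x P)" using r that F x(2) by blast
        then show ?thesis using that F x(1) by (auto simp: mem_annihilator_self)
      qed
      ultimately have "I \<subseteq> {y \<in> carrier R. r \<otimes> y = \<zero>}"
        unfolding F(3) by (intro genideal_minimal) auto
      then have "r \<otimes> x Q = \<zero>" using xQ by auto
      then have "r \<in> ?ann (x Q)" using r by (simp add: mem_annihilator_self)
      then show "r \<in> Q" using x(2)[OF Q] by simp
    qed
    then obtain P where P: "P \<in> F" "P \<subseteq> Q"
      using Q.finite_Inter_subset_prime[of F] F ideal by blast
    then have "maximal_in P (Ass R (self_module R))" using F by auto
    then have "Q = P" using P Q by (auto simp: maximal_in_def)
    then show ?thesis using P by simp
  qed
  then have "?X \<subseteq> F" by blast
  then show ?thesis using F finite_subset by blast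
qed

lemma zero_divisor_ideal_subset_maximal_in_Ass:
  fixes R (structure)
  assumes "cring R" "noetherian_ring R" "ideal J R" "J \<inter> non_zero_divisors R = {}"
  shows "\<exists>P. maximal_in P (Ass R (self_module R)) \<and> J \<subseteq> P"
proof -
  interpret cring R by fact
  let ?X = "{P. maximal_in P (Ass R (self_module R))}"
  have "J \<subseteq> \<Union>?X"
  proof
    fix r assume r: "r \<in> J"
    then have rc: "r \<in> carrier R" using additive_subgroup.a_subset ideal.axioms(1)[OF assms(3)] by blast
    have "r \<notin> non_zero_divisors R" using r assms(4) by blast
    then obtain x where x: "x \<in> carrier R" "r \<otimes> x = \<zero>" "x \<noteq> \<zero>"
      using rc by (auto simp: non_zero_divisors_def)
    have "\<exists>P. maximal_in P (Ass R (self_module R)) \<and> annihilator R (self_module R) x \<subseteq> P"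
      using x assms by (intro annihilator_subset_maximal_in_Ass self_module_is_module)
        (auto simp: self_module_def)
    moreover have "r \<in> annihilator R (self_module R) x" using rc x by (simp add: mem_annihilator_self)
    ultimately show "r \<in> \<Union>?X" by blast
  qed
  then have "\<exists>P\<in>?X. J \<subseteq> P"
    using assms by (intro prime_avoidance finite_maximal_in_Ass_self)
      (auto simp: maximal_in_def Ass_def)
  then show ?thesis by blast
qed

section \<open>Simple torsion-free modules\<close>

lemma (in cring) non_zero_divisors_mult:
  assumes "s \<in> non_zero_divisors R" "t \<in> non_zero_divisors R"
  shows "s \<otimes> t \<in> non_zero_divisors R"
proof -
  have c: "s \<in> carrier R" "t \<in> carrier R" using assms by (simp_all add: non_zero_divisors_def)
  have "x = \<zero>" if "x \<in> carrier R" "s \<otimes> t \<otimes> x = \<zero>" for x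
  proof -
    have "s \<otimes> (t \<otimes> x) = \<zero>" using that c by (simp add: m_assoc)
    then have "t \<otimes> x = \<zero>" using assms(1) that c unfolding non_zero_divisors_def by blast
    then show ?thesis using assms(2) that unfolding non_zero_divisors_def by blast
  qed
  then show ?thesis using c unfolding non_zero_divisors_def by blast
qed

lemma (in Module.module) minus_eq_zero_iff:
  assumes "x \<in> carrier M" "y \<in> carrier M"
  shows "x \<ominus>\<^bsub>M\<^esub> y = \<zero>\<^bsub>M\<^esub> \<longleftrightarrow> x = y"
  using assms by (metis M.add.inv_closed M.add.inv_equality M.add.inv_inv M.minus_eq M.r_neg)

lemma (in Module.module) torsion_free_iff:
  "torsion_free R M \<longleftrightarrow> (\<forall>x\<in>carrier M - {\<zero>\<^bsub>M\<^esub>}. annihilator R M x \<inter> non_zero_divisors R = {})"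
proof -
  have nzc: "r \<in> carrier R" if "r \<in> non_zero_divisors R" for r
    using that by (simp add: non_zero_divisors_def)
  have inj: "inj_on (\<lambda>x. r \<odot>\<^bsub>M\<^esub> x) (carrier M)
      \<longleftrightarrow> (\<forall>x\<in>carrier M. r \<odot>\<^bsub>M\<^esub> x = \<zero>\<^bsub>M\<^esub> \<longrightarrow> x = \<zero>\<^bsub>M\<^esub>)" if r: "r \<in> carrier R" for r
  proof
    assume "inj_on (\<lambda>x. r \<odot>\<^bsub>M\<^esub> x) (carrier M)"
    then show "\<forall>x\<in>carrier M. r \<odot>\<^bsub>M\<^esub> x = \<zero>\<^bsub>M\<^esub> \<longrightarrow> x = \<zero>\<^bsub>M\<^esub>"
      using r by (auto dest: inj_onD[where y = "\<zero>\<^bsub>M\<^esub>"])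
  next
    assume *: "\<forall>x\<in>carrier M. r \<odot>\<^bsub>M\<^esub> x = \<zero>\<^bsub>M\<^esub> \<longrightarrow> x = \<zero>\<^bsub>M\<^esub>"
    show "inj_on (\<lambda>x. r \<odot>\<^bsub>M\<^esub> x) (carrier M)"
    proof (rule inj_onI)
      fix x y assume xy: "x \<in> carrier M" "y \<in> carrier M" "r \<odot>\<^bsub>M\<^esub> x = r \<odot>\<^bsub>M\<^esub> y"
      then have "r \<odot>\<^bsub>M\<^esub> (x \<ominus>\<^bsub>M\<^esub> y) = \<zero>\<^bsub>M\<^esub>"
        using r by (simp add: M.minus_eq smult_r_distr smult_r_minus M.r_neg)
      then have "x \<ominus>\<^bsub>M\<^esub> y = \<zero>\<^bsub>M\<^esub>" using * xy(1,2) by (blast intro: M.minus_closed)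
      then show "x = y" using xy minus_eq_zero_iff by simp
    qed
  qed
  have "torsion_free R M \<longleftrightarrow> (\<forall>r\<in>non_zero_divisors R. \<forall>x\<in>carrier M. r \<odot>\<^bsub>M\<^esub> x = \<zero>\<^bsub>M\<^esub> \<longrightarrow> x = \<zero>\<^bsub>M\<^esub>)"
    unfolding torsion_free_def using inj nzc by blast
  also have "\<dots> \<longleftrightarrow> (\<forall>x\<in>carrier M - {\<zero>\<^bsub>M\<^esub>}. annihilator R M x \<inter> non_zero_divisors R = {})"
    using nzc unfolding annihilator_def by blast
  finally show ?thesis .
qed

lemma (in Module.module) torsion_free_quot_module_iff:
  assumes "submodule U R M"
  shows "torsion_free R (quot_module R M U) \<longleftrightarrow>
    (\<forall>r\<in>non_zero_divisors R. \<forall>x\<in>carrier M. r \<odot>\<^bsub>M\<^esub> x \<in> U \<longrightarrow> x \<in> U)"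
proof -
  have nzc: "r \<in> carrier R" if "r \<in> non_zero_divisors R" for r
    using that by (simp add: non_zero_divisors_def)
  let ?Q = "quot_module R M U"
  interpret Q: Module.module R ?Q by (rule quot_module_is_module[OF module_axioms assms])
  interpret A: abelian_subgroup U M by (rule abelian_subgroup_if_submodule[OF module_axioms assms])
  have car: "carrier ?Q = (\<lambda>x. U +>\<^bsub>M\<^esub> x) ` carrier M"
    by (auto simp: quot_module_def A_RCOSETS_def')
  have zero: "U +>\<^bsub>M\<^esub> x = \<zero>\<^bsub>?Q\<^esub> \<longleftrightarrow> x \<in> U" if "x \<in> carrier M" for x
    using that A.a_rcos_const[of x] A.a_rcos_self[of x] by (auto simp: quot_module_def)
  have "torsion_free R ?Q \<longleftrightarrow> (\<forall>r\<in>non_zero_divisors R. \<forall>X\<in>carrier ?Q.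
      r \<odot>\<^bsub>?Q\<^esub> X = \<zero>\<^bsub>?Q\<^esub> \<longrightarrow> X = \<zero>\<^bsub>?Q\<^esub>)"
    unfolding Q.torsion_free_iff using nzc unfolding annihilator_def by blast
  also have "\<dots> \<longleftrightarrow> (\<forall>r\<in>non_zero_divisors R. \<forall>x\<in>carrier M. r \<odot>\<^bsub>M\<^esub> x \<in> U \<longrightarrow> x \<in> U)"
    unfolding car ball_simps
  proof (intro ball_cong refl)
    fix r x assume r: "r \<in> non_zero_divisors R" and x: "x \<in> carrier M"
    have rc: "r \<in> carrier R" using r by (simp add: non_zero_divisors_def)
    show "(r \<odot>\<^bsub>?Q\<^esub> (U +>\<^bsub>M\<^esub> x) = \<zero>\<^bsub>?Q\<^esub> \<longrightarrow> U +>\<^bsub>M\<^esub> x = \<zero>\<^bsub>?Q\<^esub>) = (r \<odot>\<^bsub>M\<^esub> x \<in> U \<longrightarrow> x \<in> U)"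
      unfolding quot_module_smult[OF module_axioms assms rc x]
      using zero x rc by simp
  qed
  finally show ?thesis .
qed

text \<open>
  The second condition says that the saturation of each nonzero cyclic submodule is all of \<open>M\<close>. It is
  necessary because the quotient by a saturation is torsion-free. It is sufficient because a
  submodule with torsion-free quotient contains the saturation of each of its cyclic submodules.
\<close>

lemma (in Module.module) simple_torsion_free_iff:
  assumes "carrier M \<noteq> {\<zero>\<^bsub>M\<^esub>}"
  shows "simple_torsion_free R M \<longleftrightarrow>
    (\<forall>m\<in>carrier M - {\<zero>\<^bsub>M\<^esub>}. annihilator R M m \<inter> non_zero_divisors R = {} \<and>
      (\<forall>n\<in>carrier M. \<exists>t\<in>non_zero_divisors R. \<exists>r\<in>carrier R. t \<odot>\<^bsub>M\<^esub> n = r \<odot>\<^bsub>M\<^esub> m))"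
    (is "_ \<longleftrightarrow> (\<forall>m\<in>?M0. ?tf m \<and> (\<forall>n\<in>carrier M. ?dep m n))")
proof
  assume simple: "simple_torsion_free R M"
  then have tf: "torsion_free R M" by (simp add: simple_torsion_free_def)
  show "\<forall>m\<in>?M0. ?tf m \<and> (\<forall>n\<in>carrier M. ?dep m n)"
  proof
    fix m assume m: "m \<in> ?M0"
    define V where "V = {n \<in> carrier M. ?dep m n}"
    have nzc: "t \<in> carrier R" if "t \<in> non_zero_divisors R" for t
      using that by (simp add: non_zero_divisors_def)
    have one: "\<one>\<^bsub>R\<^esub> \<in> non_zero_divisors R" by (simp add: non_zero_divisors_def)
    have VI: "n \<in> V" if "n \<in> carrier M" "t \<in> non_zero_divisors R" "r \<in> carrier R"
      "t \<odot>\<^bsub>M\<^esub> n = r \<odot>\<^bsub>M\<^esub> m" for n t r using that by (auto simp: V_def)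
    have VE: "\<exists>t r. n \<in> carrier M \<and> t \<in> non_zero_divisors R \<and> r \<in> carrier R \<and> t \<odot>\<^bsub>M\<^esub> n = r \<odot>\<^bsub>M\<^esub> m"
      if "n \<in> V" for n using that by (auto simp: V_def)
    have smult_V: "a \<odot>\<^bsub>M\<^esub> n \<in> V" if a: "a \<in> carrier R" and n: "n \<in> V" for a n
    proof -
      obtain t r where h: "n \<in> carrier M" "t \<in> non_zero_divisors R" "r \<in> carrier R" "t \<odot>\<^bsub>M\<^esub> n = r \<odot>\<^bsub>M\<^esub> m"
        using VE[OF n] by blast
      have "t \<odot>\<^bsub>M\<^esub> (a \<odot>\<^bsub>M\<^esub> n) = (a \<otimes>\<^bsub>R\<^esub> t) \<odot>\<^bsub>M\<^esub> n"
        using a h nzc by (simp add: smult_assoc1[symmetric] R.m_comm)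
      also have "\<dots> = (a \<otimes>\<^bsub>R\<^esub> r) \<odot>\<^bsub>M\<^esub> m" using a h nzc m by (simp add: smult_assoc1)
      finally show ?thesis using a h by (intro VI[of _ t "a \<otimes>\<^bsub>R\<^esub> r"]) auto
    qed
    have sub: "submodule V R M"
    proof (rule submoduleI)
      show "V \<subseteq> carrier M" by (auto simp: V_def)
      show "\<zero>\<^bsub>M\<^esub> \<in> V" using m by (intro VI[of _ "\<one>\<^bsub>R\<^esub>" "\<zero>\<^bsub>R\<^esub>"] one) auto
      show "a \<odot>\<^bsub>M\<^esub> n \<in> V" if "a \<in> carrier R" "n \<in> V" for a n using that by (rule smult_V)
      show "\<ominus>\<^bsub>M\<^esub> n \<in> V" if "n \<in> V" for n
        using smult_V[of "\<ominus>\<^bsub>R\<^esub> \<one>\<^bsub>R\<^esub>" n] that by (auto simp: smult_l_minus V_def)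
      show "n \<oplus>\<^bsub>M\<^esub> n' \<in> V" if nn: "n \<in> V" "n' \<in> V" for n n'
      proof -
        obtain t r where h: "n \<in> carrier M" "t \<in> non_zero_divisors R" "r \<in> carrier R" "t \<odot>\<^bsub>M\<^esub> n = r \<odot>\<^bsub>M\<^esub> m"
          using VE[OF nn(1)] by blast
        obtain t' r' where h': "n' \<in> carrier M" "t' \<in> non_zero_divisors R" "r' \<in> carrier R" "t' \<odot>\<^bsub>M\<^esub> n' = r' \<odot>\<^bsub>M\<^esub> m"
          using VE[OF nn(2)] by blast
        have "(t \<otimes>\<^bsub>R\<^esub> t') \<odot>\<^bsub>M\<^esub> (n \<oplus>\<^bsub>M\<^esub> n')
          = (t' \<otimes>\<^bsub>R\<^esub> t) \<odot>\<^bsub>M\<^esub> n \<oplus>\<^bsub>M\<^esub> (t \<otimes>\<^bsub>R\<^esub> t') \<odot>\<^bsub>M\<^esub> n'"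
          using h h' nzc by (simp add: smult_r_distr R.m_comm[of t t'])
        also have "\<dots> = (t' \<otimes>\<^bsub>R\<^esub> r \<oplus>\<^bsub>R\<^esub> t \<otimes>\<^bsub>R\<^esub> r') \<odot>\<^bsub>M\<^esub> m"
          using h h' nzc m by (simp add: smult_assoc1 smult_l_distr)
        finally show ?thesis
          using h h' nzc by (intro VI[of _ "t \<otimes>\<^bsub>R\<^esub> t'" "t' \<otimes>\<^bsub>R\<^esub> r \<oplus>\<^bsub>R\<^esub> t \<otimes>\<^bsub>R\<^esub> r'"] R.non_zero_divisors_mult) auto
      qed
    qed
    have "m \<in> V" using m by (intro VI[of _ "\<one>\<^bsub>R\<^esub>" "\<one>\<^bsub>R\<^esub>"] one) auto
    then have "V \<noteq> {\<zero>\<^bsub>M\<^esub>}" using m by auto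
    moreover have "torsion_free R (quot_module R M V)"
      unfolding torsion_free_quot_module_iff[OF sub]
    proof (intro ballI impI)
      fix s x assume s: "s \<in> non_zero_divisors R" and x: "x \<in> carrier M" "s \<odot>\<^bsub>M\<^esub> x \<in> V"
      then obtain t r where h: "t \<in> non_zero_divisors R" "r \<in> carrier R" "t \<odot>\<^bsub>M\<^esub> (s \<odot>\<^bsub>M\<^esub> x) = r \<odot>\<^bsub>M\<^esub> m"
        using VE by blast
      then show "x \<in> V" using s x nzc
        by (intro VI[of _ "t \<otimes>\<^bsub>R\<^esub> s" r] R.non_zero_divisors_mult) (auto simp: smult_assoc1)
    qed
    ultimately have "V = carrier M"
      using simple sub submoduleE(1)[OF sub] unfolding simple_torsion_free_def by blast
    then show "?tf m \<and> (\<forall>n\<in>carrier M. ?dep m n)"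
      using tf m unfolding torsion_free_iff V_def by blast
  qed
next
  assume *: "\<forall>m\<in>?M0. ?tf m \<and> (\<forall>n\<in>carrier M. ?dep m n)"
  have "\<not> torsion_free R (quot_module R M U)"
    if U: "submodule U R M" "U \<noteq> {\<zero>\<^bsub>M\<^esub>}" "U \<subset> carrier M" for U
  proof
    assume tfU: "torsion_free R (quot_module R M U)"
    interpret A: abelian_subgroup U M by (rule abelian_subgroup_if_submodule[OF module_axioms U(1)])
    obtain m where m: "m \<in> U" "m \<noteq> \<zero>\<^bsub>M\<^esub>" using U(2) A.zero_closed by blast
    obtain n where n: "n \<in> carrier M" "n \<notin> U" using U(3) by blast
    have "m \<in> ?M0" using m U(3) by auto
    then have "?dep m n" using bspec[OF *] n(1) by blast
    then obtain t r where t: "t \<in> non_zero_divisors R" "r \<in> carrier R" "t \<odot>\<^bsub>M\<^esub> n = r \<odot>\<^bsub>M\<^esub> m"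
      by blast
    then have "t \<odot>\<^bsub>M\<^esub> n \<in> U" using submodule.smult_closed[OF U(1)] m by simp
    then show False using tfU t n unfolding torsion_free_quot_module_iff[OF U(1)] by blast
  qed
  moreover have "torsion_free R M" unfolding torsion_free_iff using * by simp
  ultimately show "simple_torsion_free R M" using assms unfolding simple_torsion_free_def by simp
qed

section \<open>The residue field as a module\<close>

text \<open>The class of the fraction \<open>a/s\<close> in \<open>\<kappa>(\<pp>)\<close>.\<close>

definition residue_frac :: "('a, 'c) ring_scheme \<Rightarrow> 'a set \<Rightarrow> 'a \<Rightarrow> 'a \<Rightarrow> ('a \<times> 'a) set set"
  where "residue_frac R \<pp> a s =
    extended_ideal R \<pp> +>\<^bsub>localization_at R \<pp>\<^esub> loc_frac R (carrier R - \<pp>) a s"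

context
  fixes R (structure) and \<pp>
  assumes prime: "primeideal \<pp> R"
begin

interpretation primeideal \<pp> R by (rule prime)
interpretation S: mult_subset R "carrier R - \<pp>" by (rule mult_subset_prime[OF prime])
interpretation L: cring "localization_at R \<pp>"
  unfolding localization_at_def by (rule S.loc_cring)

lemma localization_at_eq: "localization_at R \<pp> = S.L" by (simp add: localization_at_def)

lemma localization_map_image_subset: "localization_map R \<pp> ` \<pp> \<subseteq> carrier (localization_at R \<pp>)"
  using a_subset S.one_S by (auto simp: localization_map_def localization_at_eq S.loc_carrier)

lemma extended_ideal_is_ideal: "ideal (extended_ideal R \<pp>) (localization_at R \<pp>)"
  unfolding extended_ideal_def by (rule L.genideal_ideal[OF localization_map_image_subset])

interpretation E: ideal "extended_ideal R \<pp>" "localization_at R \<pp>"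
  by (rule extended_ideal_is_ideal)

text \<open>
  The fractions with numerator in \<open>\<pp>\<close> form an ideal, which is therefore \<open>\<pp>R\<^sub>\<pp>\<close>. Being such a fraction
  does not depend on the representative, because \<open>\<pp>\<close> is prime.
\<close>

lemma fr_mem_extended_ideal_iff:
  assumes a: "a \<in> carrier R" and s: "s \<in> carrier R - \<pp>"
  shows "S.fr a s \<in> extended_ideal R \<pp> \<longleftrightarrow> a \<in> \<pp>"
proof
  define J where "J = {S.fr b t | b t. b \<in> \<pp> \<and> t \<in> carrier R - \<pp>}"
  have JI: "S.fr b t \<in> J" if "b \<in> \<pp>" "t \<in> carrier R - \<pp>" for b t using that by (auto simp: J_def)
  have "ideal J (localization_at R \<pp>)"
  proof (rule L.ideal_if_closed)
    show "J \<subseteq> carrier (localization_at R \<pp>)"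
      using a_subset by (auto simp: J_def localization_at_eq S.loc_carrier)
    show "\<zero>\<^bsub>localization_at R \<pp>\<^esub> \<in> J"
      unfolding localization_at_eq S.loc_zero by (intro JI S.one_S) simp
  next
    fix x y assume "x \<in> J" "y \<in> J"
    then obtain b t c u where h: "x = S.fr b t" "b \<in> \<pp>" "t \<in> carrier R - \<pp>"
      "y = S.fr c u" "c \<in> \<pp>" "u \<in> carrier R - \<pp>" unfolding J_def by blast
    have "x \<oplus>\<^bsub>localization_at R \<pp>\<^esub> y = S.fr (b \<otimes> u \<oplus> c \<otimes> t) (t \<otimes> u)"
      unfolding localization_at_eq h by (rule S.loc_add) (use h Icarr in auto)
    moreover have "b \<otimes> u \<oplus> c \<otimes> t \<in> \<pp>" using h by (intro additive_subgroup.a_closed[OF is_additive_subgroup] I_r_closed) auto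
    ultimately show "x \<oplus>\<^bsub>localization_at R \<pp>\<^esub> y \<in> J" using JI S.mult_S h by simp
  next
    fix r x assume "r \<in> carrier (localization_at R \<pp>)" "x \<in> J"
    then obtain b t c u where h: "r = S.fr b t" "b \<in> carrier R" "t \<in> carrier R - \<pp>"
      "x = S.fr c u" "c \<in> \<pp>" "u \<in> carrier R - \<pp>"
      unfolding J_def localization_at_eq S.loc_carrier by blast
    have "r \<otimes>\<^bsub>localization_at R \<pp>\<^esub> x = S.fr (b \<otimes> c) (t \<otimes> u)"
      unfolding localization_at_eq h by (rule S.loc_mult) (use h Icarr in auto)
    moreover have "b \<otimes> c \<in> \<pp>" using h by (intro I_l_closed) auto
    ultimately show "r \<otimes>\<^bsub>localization_at R \<pp>\<^esub> x \<in> J" using JI S.mult_S h by simp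
  qed
  moreover have "localization_map R \<pp> ` \<pp> \<subseteq> J"
    using JI S.one_S by (auto simp: localization_map_def)
  ultimately have sub: "extended_ideal R \<pp> \<subseteq> J"
    unfolding extended_ideal_def by (rule L.genideal_minimal)
  assume "S.fr a s \<in> extended_ideal R \<pp>"
  then obtain b t where b: "S.fr a s = S.fr b t" "b \<in> \<pp>" "t \<in> carrier R - \<pp>"
    using sub unfolding J_def by blast
  then obtain u where u: "u \<in> carrier R - \<pp>" "u \<otimes> (a \<otimes> t) = u \<otimes> (b \<otimes> s)"
    using S.fr_eq[OF a s Icarr[OF b(2)] b(3)] by blast
  have "u \<otimes> (b \<otimes> s) \<in> \<pp>" using b u s by (intro I_l_closed I_r_closed) auto
  then have "a \<otimes> t \<in> \<pp>" using I_prime[of u "a \<otimes> t"] u a b by auto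
  then show "a \<in> \<pp>" using I_prime[of a t] a b by auto
next
  assume ap: "a \<in> \<pp>"
  have "S.fr a \<one> \<in> extended_ideal R \<pp>"
    using L.genideal_self[OF localization_map_image_subset] ap
    by (auto simp: extended_ideal_def localization_map_def)
  moreover have "S.fr \<one> s \<in> carrier (localization_at R \<pp>)"
    using s by (auto simp: localization_at_eq S.loc_carrier)
  ultimately have "S.fr \<one> s \<otimes>\<^bsub>localization_at R \<pp>\<^esub> S.fr a \<one> \<in> extended_ideal R \<pp>"
    by (rule E.I_l_closed)
  moreover have "S.fr \<one> s \<otimes>\<^bsub>localization_at R \<pp>\<^esub> S.fr a \<one> = S.fr a s"
    using a s S.one_S by (simp add: localization_at_eq S.loc_mult)
  ultimately show "S.fr a s \<in> extended_ideal R \<pp>" by simp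
qed

lemma fr_carrier: "a \<in> carrier R \<Longrightarrow> s \<in> carrier R - \<pp> \<Longrightarrow> S.fr a s \<in> carrier (localization_at R \<pp>)"
  by (auto simp: localization_at_eq S.loc_carrier)

lemma residue_frac_eq_iff:
  assumes a: "a \<in> carrier R" "s \<in> carrier R - \<pp>" and b: "b \<in> carrier R" "t \<in> carrier R - \<pp>"
  shows "residue_frac R \<pp> a s = residue_frac R \<pp> b t \<longleftrightarrow> a \<otimes> t \<ominus> b \<otimes> s \<in> \<pp>"
proof -
  have "S.fr (\<ominus> b) t \<oplus>\<^bsub>localization_at R \<pp>\<^esub> S.fr b t = \<zero>\<^bsub>localization_at R \<pp>\<^esub>"
    using b S.one_S S.mult_S
    by (simp add: localization_at_eq S.loc_add S.loc_zero l_minus l_neg) (rule S.fr_eqI; simp)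
  then have m: "\<ominus>\<^bsub>localization_at R \<pp>\<^esub> S.fr b t = S.fr (\<ominus> b) t"
    using b by (intro L.minus_equality fr_carrier) auto
  have "residue_frac R \<pp> a s = residue_frac R \<pp> b t \<longleftrightarrow>
      S.fr a s \<ominus>\<^bsub>localization_at R \<pp>\<^esub> S.fr b t \<in> extended_ideal R \<pp>"
    unfolding residue_frac_def
    using L.quotient_eq_iff_same_a_r_cos[OF extended_ideal_is_ideal fr_carrier[OF a] fr_carrier[OF b]] by simp
  also have "S.fr a s \<ominus>\<^bsub>localization_at R \<pp>\<^esub> S.fr b t = S.fr (a \<otimes> t \<ominus> b \<otimes> s) (s \<otimes> t)"
    unfolding L.minus_eq m using a b by (simp add: localization_at_eq S.loc_add minus_eq l_minus)
  also have "\<dots> \<in> extended_ideal R \<pp> \<longleftrightarrow> a \<otimes> t \<ominus> b \<otimes> s \<in> \<pp>"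
    using a b S.mult_S by (intro fr_mem_extended_ideal_iff) auto
  finally show ?thesis .
qed

lemma residue_module_carrier:
  "carrier (residue_module R \<pp>) = {residue_frac R \<pp> a s | a s. a \<in> carrier R \<and> s \<in> carrier R - \<pp>}"
  by (auto simp: residue_module_def residue_field_def FactRing_def A_RCOSETS_def' residue_frac_def
      localization_at_eq S.loc_carrier)

lemma residue_module_add:
  assumes "a \<in> carrier R" "s \<in> carrier R - \<pp>" "b \<in> carrier R" "t \<in> carrier R - \<pp>"
  shows "residue_frac R \<pp> a s \<oplus>\<^bsub>residue_module R \<pp>\<^esub> residue_frac R \<pp> b t
    = residue_frac R \<pp> (a \<otimes> t \<oplus> b \<otimes> s) (s \<otimes> t)"
  using E.a_rcos_sum[OF fr_carrier fr_carrier, of a s b t] assms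
  by (simp add: residue_module_def residue_field_def FactRing_def residue_frac_def
      localization_at_eq S.loc_add)

lemma residue_module_smult:
  assumes "r \<in> carrier R" "a \<in> carrier R" "s \<in> carrier R - \<pp>"
  shows "r \<odot>\<^bsub>residue_module R \<pp>\<^esub> residue_frac R \<pp> a s = residue_frac R \<pp> (r \<otimes> a) s"
  using E.rcoset_mult_add[OF fr_carrier fr_carrier, of r \<one> a s] assms S.one_S
  by (simp add: residue_module_def residue_field_def FactRing_def residue_frac_def
      localization_at_eq S.loc_mult localization_map_def)

lemma residue_module_zero: "\<zero>\<^bsub>residue_module R \<pp>\<^esub> = residue_frac R \<pp> \<zero> \<one>"
proof -
  have "S.fr \<zero> \<one> \<in> extended_ideal R \<pp>" using S.one_S by (simp add: fr_mem_extended_ideal_iff)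
  then show ?thesis
    using L.a_rcos_zero[OF extended_ideal_is_ideal]
    by (simp add: residue_module_def residue_field_def FactRing_def residue_frac_def)
qed

lemma residue_frac_eq_zero_iff:
  assumes "a \<in> carrier R" "s \<in> carrier R - \<pp>"
  shows "residue_frac R \<pp> a s = \<zero>\<^bsub>residue_module R \<pp>\<^esub> \<longleftrightarrow> a \<in> \<pp>"
  using residue_frac_eq_iff[of a s \<zero> \<one>] assms S.one_S
  by (simp add: residue_module_zero minus_eq)

end

text \<open>
  This characterizes the nonzero submodules of \<open>\<kappa>(\<pp>)\<close> up to isomorphism without reference to
  localization. For the construction of an embedding, fix \<open>m \<noteq> 0\<close> and send \<open>n\<close> to \<open>r/s\<close> when
  \<open>s n = r m\<close>; the class of \<open>r/s\<close> is determined by \<open>n\<close> since \<open>ann(m) = \<pp>\<close>.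
\<close>

lemma embeds_in_residue_module_iff:
  fixes R (structure)
  assumes prime: "primeideal \<pp> R" and M: "Module.module R M" and nonzero: "carrier M \<noteq> {\<zero>\<^bsub>M\<^esub>}"
  shows "(\<exists>h \<in> module_homs R M (residue_module R \<pp>). inj_on h (carrier M)) \<longleftrightarrow>
    (\<forall>m\<in>carrier M - {\<zero>\<^bsub>M\<^esub>}. annihilator R M m = \<pp> \<and>
      (\<forall>n\<in>carrier M. \<exists>s\<in>carrier R - \<pp>. \<exists>r\<in>carrier R. s \<odot>\<^bsub>M\<^esub> n = r \<odot>\<^bsub>M\<^esub> m))"
    (is "?emb \<longleftrightarrow> (\<forall>m\<in>?M0. ?ann m \<and> (\<forall>n\<in>carrier M. ?dep m n))")
proof -
  interpret P: primeideal \<pp> R by fact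
  interpret S: mult_subset R "carrier R - \<pp>" by (rule mult_subset_prime) fact
  note S.S_c[simp del]
  interpret M: Module.module R M by fact
  let ?K = "residue_module R \<pp>" and ?q = "residue_frac R \<pp>"
  interpret K: Module.module R ?K by (rule residue_module_is_module) fact
  note car = residue_module_carrier[OF prime] and K_smult = residue_module_smult[OF prime]
    and K_add = residue_module_add[OF prime] and q_eq = residue_frac_eq_iff[OF prime]
    and q_zero = residue_frac_eq_zero_iff[OF prime]
  show ?thesis
  proof
    assume ?emb
    then obtain h where h: "h \<in> module_homs R M ?K" "inj_on h (carrier M)" by blast
    have h_car: "h x \<in> carrier ?K" if "x \<in> carrier M" for x
      using h(1) that by (auto simp: module_homs_def)
    have h_smult: "h (r \<odot>\<^bsub>M\<^esub> x) = r \<odot>\<^bsub>?K\<^esub> h x" if "r \<in> carrier R" "x \<in> carrier M" for r x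
      using h(1) that by (auto simp: module_homs_def)
    have "h \<zero>\<^bsub>M\<^esub> = \<zero>\<^bsub>?K\<^esub>" using h_smult[of \<zero> "\<zero>\<^bsub>M\<^esub>"] h_car[of "\<zero>\<^bsub>M\<^esub>"] by simp
    then have h_zero: "h x = \<zero>\<^bsub>?K\<^esub> \<longleftrightarrow> x = \<zero>\<^bsub>M\<^esub>" if "x \<in> carrier M" for x
      using inj_onD[OF h(2), of x "\<zero>\<^bsub>M\<^esub>"] that by auto
    show "\<forall>m\<in>?M0. ?ann m \<and> (\<forall>n\<in>carrier M. ?dep m n)"
    proof (intro ballI conjI)
      fix m assume m: "m \<in> ?M0"
      then obtain a s where a: "h m = ?q a s" "a \<in> carrier R" "s \<in> carrier R - \<pp>"
        using h_car[of m] car by auto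
      have ap: "a \<notin> \<pp>" using a m h_zero[of m] q_zero[of a s] by simp
      have "r \<in> annihilator R M m \<longleftrightarrow> r \<in> \<pp>" if r: "r \<in> carrier R" for r
      proof -
        have "r \<in> annihilator R M m \<longleftrightarrow> h (r \<odot>\<^bsub>M\<^esub> m) = \<zero>\<^bsub>?K\<^esub>"
          using r m h_zero by (simp add: annihilator_def)
        also have "\<dots> \<longleftrightarrow> ?q (r \<otimes> a) s = \<zero>\<^bsub>?K\<^esub>" using r m a by (simp add: h_smult K_smult)
        also have "\<dots> \<longleftrightarrow> r \<otimes> a \<in> \<pp>" using r a by (intro q_zero) auto
        also have "\<dots> \<longleftrightarrow> r \<in> \<pp>" using P.I_prime[OF r a(2)] P.I_r_closed[OF _ a(2)] ap by blast
        finally show ?thesis .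
      qed
      moreover have "annihilator R M m \<subseteq> carrier R" by (auto simp: annihilator_def)
      ultimately show "annihilator R M m = \<pp>" using P.a_subset by blast
      fix n assume n: "n \<in> carrier M"
      then obtain b t where b: "h n = ?q b t" "b \<in> carrier R" "t \<in> carrier R - \<pp>"
        using h_car[of n] car by auto
      \<comment> \<open>With \<open>h m = a/s\<close> and \<open>h n = b/t\<close>, both \<open>t a (b/t)\<close> and \<open>s b (a/s)\<close> equal \<open>a b\<close>.\<close>
      have "h ((t \<otimes> a) \<odot>\<^bsub>M\<^esub> n) = ?q (t \<otimes> a \<otimes> b) t" using a b n by (simp add: h_smult K_smult)
      also have "\<dots> = ?q (s \<otimes> b \<otimes> a) s"
      proof -
        have "t \<otimes> a \<otimes> b \<otimes> s = s \<otimes> b \<otimes> a \<otimes> t" using a b by (simp add: P.m_ac)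
        then have "t \<otimes> a \<otimes> b \<otimes> s \<ominus> s \<otimes> b \<otimes> a \<otimes> t = \<zero>"
          using a b by (simp add: P.minus_eq P.r_neg)
        then have "t \<otimes> a \<otimes> b \<otimes> s \<ominus> s \<otimes> b \<otimes> a \<otimes> t \<in> \<pp>"
          by (simp only: additive_subgroup.zero_closed[OF P.is_additive_subgroup])
        moreover have "t \<otimes> a \<otimes> b \<in> carrier R" "s \<otimes> b \<otimes> a \<in> carrier R" using a b by auto
        ultimately show ?thesis using q_eq a(3) b(3) by blast
      qed
      also have "\<dots> = h ((s \<otimes> b) \<odot>\<^bsub>M\<^esub> m)" using a b m by (simp add: h_smult K_smult)
      finally have "(t \<otimes> a) \<odot>\<^bsub>M\<^esub> n = (s \<otimes> b) \<odot>\<^bsub>M\<^esub> m"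
        using a b m n by (intro inj_onD[OF h(2)]) auto
      moreover have "t \<otimes> a \<in> carrier R - \<pp>" using a b ap by (intro S.mult_S) auto
      moreover have "s \<otimes> b \<in> carrier R" using a b by auto
      ultimately show "?dep m n" by blast
    qed
  next
    assume *: "\<forall>m\<in>?M0. ?ann m \<and> (\<forall>n\<in>carrier M. ?dep m n)"
    obtain m where m: "m \<in> ?M0" using nonzero M.zero_closed by blast
    have mc: "m \<in> carrier M" using m by simp
    have "\<forall>n\<in>carrier M. \<exists>s r. s \<in> carrier R - \<pp> \<and> r \<in> carrier R \<and> s \<odot>\<^bsub>M\<^esub> n = r \<odot>\<^bsub>M\<^esub> m"
      using bspec[OF * m] by blast
    then obtain s r where sr: "\<And>n. n \<in> carrier M \<Longrightarrow>
        s n \<in> carrier R - \<pp> \<and> r n \<in> carrier R \<and> s n \<odot>\<^bsub>M\<^esub> n = r n \<odot>\<^bsub>M\<^esub> m"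
      by metis
    have s: "s n \<in> carrier R - \<pp>" "s n \<in> carrier R" and r: "r n \<in> carrier R"
      and sr_eq: "s n \<odot>\<^bsub>M\<^esub> n = r n \<odot>\<^bsub>M\<^esub> m" if "n \<in> carrier M" for n
      using sr[OF that] by auto
    have smult_m: "a \<odot>\<^bsub>M\<^esub> m = b \<odot>\<^bsub>M\<^esub> m \<longleftrightarrow> a \<ominus> b \<in> \<pp>" if "a \<in> carrier R" "b \<in> carrier R" for a b
    proof -
      have "a \<ominus> b \<in> \<pp> \<longleftrightarrow> (a \<ominus> b) \<odot>\<^bsub>M\<^esub> m = \<zero>\<^bsub>M\<^esub>"
        using bspec[OF * m] that by (auto simp: annihilator_def)
      also have "(a \<ominus> b) \<odot>\<^bsub>M\<^esub> m = a \<odot>\<^bsub>M\<^esub> m \<ominus>\<^bsub>M\<^esub> b \<odot>\<^bsub>M\<^esub> m"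
        using that mc by (simp add: P.minus_eq M.M.minus_eq M.smult_l_distr M.smult_l_minus)
      finally show ?thesis using that mc by (simp add: M.minus_eq_zero_iff)
    qed
    \<comment> \<open>The choice of \<open>r n\<close> and \<open>s n\<close> is immaterial by \<open>h_eq\<close>, which makes \<open>h\<close> linear.\<close>
    define h where "h = (\<lambda>n. ?q (r n) (s n))"
    have h_eq: "h n = ?q a t"
      if n: "n \<in> carrier M" "a \<in> carrier R" "t \<in> carrier R - \<pp>" "t \<odot>\<^bsub>M\<^esub> n = a \<odot>\<^bsub>M\<^esub> m" for n a t
    proof -
      have "(r n \<otimes> t) \<odot>\<^bsub>M\<^esub> m = t \<odot>\<^bsub>M\<^esub> (s n \<odot>\<^bsub>M\<^esub> n)"
        using n s r sr_eq mc by (simp add: M.smult_assoc1 P.m_comm[of "r n" t])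
      also have "\<dots> = s n \<odot>\<^bsub>M\<^esub> (t \<odot>\<^bsub>M\<^esub> n)"
        using n(1,3) s[OF n(1)] by (simp add: M.smult_assoc1[symmetric] P.m_comm)
      also have "\<dots> = (a \<otimes> s n) \<odot>\<^bsub>M\<^esub> m"
        using n s mc by (simp add: M.smult_assoc1 P.m_comm[of a "s n"])
      finally have "r n \<otimes> t \<ominus> a \<otimes> s n \<in> \<pp>" using n s r by (subst smult_m[symmetric]) auto
      then show ?thesis unfolding h_def using n s r by (subst q_eq) auto
    qed
    have "h \<in> module_homs R M ?K"
      unfolding module_homs_def
    proof (intro CollectI conjI ballI Pi_I)
      fix x assume x: "x \<in> carrier M"
      show "h x \<in> carrier ?K" using s[OF x] r[OF x] by (auto simp: car h_def)
      show "h (c \<odot>\<^bsub>M\<^esub> x) = c \<odot>\<^bsub>?K\<^esub> h x" if c: "c \<in> carrier R" for c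
      proof -
        have "s x \<odot>\<^bsub>M\<^esub> (c \<odot>\<^bsub>M\<^esub> x) = c \<odot>\<^bsub>M\<^esub> (s x \<odot>\<^bsub>M\<^esub> x)"
          using c x s[OF x] by (simp add: M.smult_assoc1[symmetric] P.m_comm)
        also have "\<dots> = (c \<otimes> r x) \<odot>\<^bsub>M\<^esub> m"
          using c x r[OF x] mc by (simp add: sr_eq M.smult_assoc1)
        finally have "h (c \<odot>\<^bsub>M\<^esub> x) = ?q (c \<otimes> r x) (s x)"
          using c x r[OF x] s[OF x] by (intro h_eq) auto
        also have "\<dots> = c \<odot>\<^bsub>?K\<^esub> h x" unfolding h_def using c r[OF x] s[OF x] by (simp add: K_smult)
        finally show ?thesis .
      qed
      fix y assume y: "y \<in> carrier M"
      have "(s x \<otimes> s y) \<odot>\<^bsub>M\<^esub> (x \<oplus>\<^bsub>M\<^esub> y) = (s y \<otimes> s x) \<odot>\<^bsub>M\<^esub> x \<oplus>\<^bsub>M\<^esub> (s x \<otimes> s y) \<odot>\<^bsub>M\<^esub> y"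
        using x y s[OF x] s[OF y] by (simp add: M.smult_r_distr P.m_comm[of "s x" "s y"])
      also have "\<dots> = (s y \<otimes> r x) \<odot>\<^bsub>M\<^esub> m \<oplus>\<^bsub>M\<^esub> (s x \<otimes> r y) \<odot>\<^bsub>M\<^esub> m"
        using x y s(2)[OF x] s(2)[OF y] r[OF x] r[OF y] mc by (simp add: M.smult_assoc1 sr_eq)
      also have "\<dots> = (r x \<otimes> s y \<oplus> r y \<otimes> s x) \<odot>\<^bsub>M\<^esub> m"
        using s(2)[OF x] s(2)[OF y] r[OF x] r[OF y] mc
        by (simp add: M.smult_l_distr P.m_comm[of "s y"] P.m_comm[of "s x"])
      finally have "h (x \<oplus>\<^bsub>M\<^esub> y) = ?q (r x \<otimes> s y \<oplus> r y \<otimes> s x) (s x \<otimes> s y)"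
        using x y s(2)[OF x] s(2)[OF y] r[OF x] r[OF y] S.mult_S[OF s(1)[OF x] s(1)[OF y]]
        by (intro h_eq) auto
      also have "\<dots> = h x \<oplus>\<^bsub>?K\<^esub> h y"
        unfolding h_def by (rule K_add[symmetric]) (use x y s r in auto)
      finally show "h (x \<oplus>\<^bsub>M\<^esub> y) = h x \<oplus>\<^bsub>?K\<^esub> h y" .
    qed
    moreover have "inj_on h (carrier M)"
    proof (rule inj_onI)
      fix x y assume x: "x \<in> carrier M" and y: "y \<in> carrier M" and "h x = h y"
      then have "r x \<otimes> s y \<ominus> r y \<otimes> s x \<in> \<pp>"
        unfolding h_def using q_eq s(1)[OF x] s(1)[OF y] r[OF x] r[OF y] by blast
      then have "(r x \<otimes> s y) \<odot>\<^bsub>M\<^esub> m = (r y \<otimes> s x) \<odot>\<^bsub>M\<^esub> m"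
        using s(2)[OF x] s(2)[OF y] r[OF x] r[OF y] by (subst smult_m) auto
      then have "(s y \<otimes> s x) \<odot>\<^bsub>M\<^esub> x = (s x \<otimes> s y) \<odot>\<^bsub>M\<^esub> y"
        using x y s(2)[OF x] s(2)[OF y] r[OF x] r[OF y] mc
        by (simp add: P.m_comm[of "r x"] P.m_comm[of "r y"] M.smult_assoc1 sr_eq)
      then have "(s x \<otimes> s y) \<odot>\<^bsub>M\<^esub> (x \<ominus>\<^bsub>M\<^esub> y) = \<zero>\<^bsub>M\<^esub>"
        using x y s(2)[OF x] s(2)[OF y]
        by (simp add: P.m_comm[of "s y" "s x"] M.M.minus_eq M.smult_r_distr M.smult_r_minus M.M.r_neg)
      then have "s x \<otimes> s y \<in> annihilator R M (x \<ominus>\<^bsub>M\<^esub> y)"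
        using s(2)[OF x] s(2)[OF y] by (simp add: annihilator_def)
      moreover have "s x \<otimes> s y \<notin> \<pp>" using S.mult_S[OF s(1)[OF x] s(1)[OF y]] by simp
      ultimately have "x \<ominus>\<^bsub>M\<^esub> y \<notin> ?M0" using * by blast
      then have "x \<ominus>\<^bsub>M\<^esub> y = \<zero>\<^bsub>M\<^esub>" using x y by simp
      then show "x = y" using x y by (simp add: M.minus_eq_zero_iff)
    qed
    ultimately show ?emb by blast
  qed
qed

section \<open>The classification\<close>

lemma maximal_in_Ass_self_disjoint:
  assumes "maximal_in P (Ass R (self_module R))"
  shows "P \<inter> non_zero_divisors R = {}"
proof -
  have "P \<in> Ass R (self_module R)" using assms by (simp add: maximal_in_def)
  then obtain x where x: "x \<in> carrier R" "x \<noteq> \<zero>\<^bsub>R\<^esub>" "P = annihilator R (self_module R) x"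
    by (rule Ass_selfD) blast
  have "r \<notin> non_zero_divisors R" if "r \<in> P" for r
    using that x(1,2) unfolding x(3) mem_annihilator_self non_zero_divisors_def by blast
  then show ?thesis by blast
qed

text \<open>
  The maximal elements of \<open>Ass(R)\<close> are even maximal among all ideals of zero divisors. Hence an
  ideal that properly contains one of them has a non-zero-divisor.
\<close>

lemma maximal_in_Ass_self_eqI:
  assumes "cring R" "noetherian_ring R" and P: "maximal_in P (Ass R (self_module R))"
    and "ideal J R" "J \<inter> non_zero_divisors R = {}" "P \<subseteq> J"
  shows "J = P"
proof -
  obtain Q where Q: "maximal_in Q (Ass R (self_module R))" "J \<subseteq> Q"
    using zero_divisor_ideal_subset_maximal_in_Ass assms by blast
  then have "Q = P" using P assms(6) unfolding maximal_in_def by blast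
  then show ?thesis using Q assms(6) by blast
qed

theorem mainTheorem1:
  fixes R :: "('a, 'c) ring_scheme" and M :: "('a, 'b, 'd) module_scheme"
  assumes "local_ring R" and "noetherian_ring R"
    and "module R M" and "carrier M \<noteq> {\<zero>\<^bsub>M\<^esub>}"
  shows "simple_torsion_free R M \<longleftrightarrow>
    (\<exists>\<pp>. maximal_in \<pp> (Ass R (self_module R)) \<and>
      (\<exists>h \<in> module_homs R M (residue_module R \<pp>). inj_on h (carrier M)))"
proof -
  interpret M: Module.module R M by fact
  let ?ann = "annihilator R M" and ?nz = "non_zero_divisors R" and ?M0 = "carrier M - {\<zero>\<^bsub>M\<^esub>}"
  let ?max = "\<lambda>P. maximal_in P (Ass R (self_module R))"
  let ?dep = "\<lambda>T m n. \<exists>t\<in>T. \<exists>r\<in>carrier R. t \<odot>\<^bsub>M\<^esub> n = r \<odot>\<^bsub>M\<^esub> m"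
  have cr: "cring R" by (rule M.R.is_cring)
  have nzc: "t \<in> carrier R" if "t \<in> ?nz" for t using that by (simp add: non_zero_divisors_def)
  have prime: "primeideal P R" if "?max P" for P using that by (simp add: maximal_in_def Ass_def)
  have "(\<forall>m\<in>?M0. ?ann m \<inter> ?nz = {} \<and> (\<forall>n\<in>carrier M. ?dep ?nz m n)) \<longleftrightarrow>
    (\<exists>P. ?max P \<and> (\<forall>m\<in>?M0. ?ann m = P \<and> (\<forall>n\<in>carrier M. ?dep (carrier R - P) m n)))"
    (is "?lhs \<longleftrightarrow> ?rhs")
  proof
    assume lhs: ?lhs
    have tf: "?ann m \<inter> ?nz = {}" if "m \<in> ?M0" for m using bspec[OF lhs that] by blast
    have dep: "?dep ?nz m n" if "m \<in> ?M0" "n \<in> carrier M" for m n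
      using bspec[OF lhs that(1)] that(2) by blast
    have max_ann: "?max (?ann m)" if m: "m \<in> ?M0" for m
    proof -
      have mc: "m \<in> carrier M" using m by simp
      obtain P where P: "?max P" "?ann m \<subseteq> P"
        using zero_divisor_ideal_subset_maximal_in_Ass[OF cr assms(2) M.annihilator_ideal[OF mc] tf[OF m]]
        by blast
      interpret P: primeideal P R by (rule prime[OF P(1)])
      have "r \<in> ?ann m" if r: "r \<in> P" for r
      proof (rule ccontr)
        have rc: "r \<in> carrier R" using r by (rule P.Icarr)
        assume "r \<notin> ?ann m"
        then have "r \<odot>\<^bsub>M\<^esub> m \<in> ?M0" using rc mc by (simp add: annihilator_def)
        then obtain t a where t: "t \<in> ?nz" "a \<in> carrier R" "t \<odot>\<^bsub>M\<^esub> m = a \<odot>\<^bsub>M\<^esub> (r \<odot>\<^bsub>M\<^esub> m)"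
          using dep mc by blast
        have tc: "t \<in> carrier R" using t nzc by simp
        have "(t \<ominus>\<^bsub>R\<^esub> a \<otimes>\<^bsub>R\<^esub> r) \<odot>\<^bsub>M\<^esub> m = \<zero>\<^bsub>M\<^esub>"
          using t tc rc mc by (simp add: M.R.minus_eq M.smult_l_distr M.smult_l_minus M.smult_assoc1 M.M.r_neg)
        then have d: "t \<ominus>\<^bsub>R\<^esub> a \<otimes>\<^bsub>R\<^esub> r \<in> P" using t tc rc P(2) by (auto simp: annihilator_def)
        have "t = (t \<ominus>\<^bsub>R\<^esub> a \<otimes>\<^bsub>R\<^esub> r) \<oplus>\<^bsub>R\<^esub> a \<otimes>\<^bsub>R\<^esub> r"
          using t tc rc by (simp add: M.R.minus_eq M.R.a_assoc M.R.l_neg)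
        then have "t \<in> P"
          using additive_subgroup.a_closed[OF P.is_additive_subgroup d P.I_l_closed[OF r t(2)]] by simp
        then show False using t maximal_in_Ass_self_disjoint[OF P(1)] by blast
      qed
      then have "?ann m = P" using P(2) by blast
      then show ?thesis using P by simp
    qed
    obtain m where m: "m \<in> ?M0" using assms(4) M.zero_closed by blast
    have mc: "m \<in> carrier M" using m by simp
    \<comment> \<open>\<open>ann(m)\<close> kills all of \<open>M\<close>, because \<open>t r n = a r m = 0\<close> forces \<open>r n = 0\<close>.\<close>
    have all: "?ann n = ?ann m" if n: "n \<in> ?M0" for n
    proof -
      have nc: "n \<in> carrier M" using n by simp
      have "r \<in> ?ann n" if r: "r \<in> ?ann m" for r
      proof (rule ccontr)
        have rc: "r \<in> carrier R" "r \<odot>\<^bsub>M\<^esub> m = \<zero>\<^bsub>M\<^esub>" using r by (simp_all add: annihilator_def)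
        assume "r \<notin> ?ann n"
        then have rn: "r \<odot>\<^bsub>M\<^esub> n \<in> ?M0" using rc nc by (simp add: annihilator_def)
        obtain t a where t: "t \<in> ?nz" "a \<in> carrier R" "t \<odot>\<^bsub>M\<^esub> n = a \<odot>\<^bsub>M\<^esub> m"
          using dep m nc by blast
        have tc: "t \<in> carrier R" using t nzc by simp
        have "t \<odot>\<^bsub>M\<^esub> (r \<odot>\<^bsub>M\<^esub> n) = r \<odot>\<^bsub>M\<^esub> (t \<odot>\<^bsub>M\<^esub> n)"
          using tc rc nc by (simp add: M.smult_assoc1[symmetric] M.R.m_comm)
        also have "\<dots> = a \<odot>\<^bsub>M\<^esub> (r \<odot>\<^bsub>M\<^esub> m)"
          unfolding t(3) using t rc(1) mc by (simp add: M.smult_assoc1[symmetric] M.R.m_comm)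
        also have "\<dots> = \<zero>\<^bsub>M\<^esub>" using rc t by simp
        finally have "t \<in> ?ann (r \<odot>\<^bsub>M\<^esub> n)" using tc by (simp add: annihilator_def)
        then show False using tf[OF rn] t by blast
      qed
      then have "?ann m \<subseteq> ?ann n" by blast
      then show ?thesis using max_ann[OF m] max_ann[OF n] unfolding maximal_in_def by blast
    qed
    have "?nz \<subseteq> carrier R - ?ann m" using nzc tf[OF m] by blast
    then have "?dep (carrier R - ?ann m) k n" if "k \<in> ?M0" "n \<in> carrier M" for k n
      using dep[OF that] by blast
    then show ?rhs using max_ann[OF m] all by blast
  next
    assume ?rhs
    then obtain P where P: "?max P"
      and *: "\<forall>m\<in>?M0. ?ann m = P \<and> (\<forall>n\<in>carrier M. ?dep (carrier R - P) m n)" by blast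
    note disj = maximal_in_Ass_self_disjoint[OF P]
    have "?dep ?nz m n" if m: "m \<in> ?M0" and n: "n \<in> carrier M" for m n
    proof -
      have mc: "m \<in> carrier M" using m by simp
      define J where "J = {t \<in> carrier R. \<exists>r\<in>carrier R. t \<odot>\<^bsub>M\<^esub> n = r \<odot>\<^bsub>M\<^esub> m}"
      have "ideal J R"
      proof (rule M.R.ideal_if_closed)
        show "J \<subseteq> carrier R" by (auto simp: J_def)
        have "\<zero>\<^bsub>R\<^esub> \<odot>\<^bsub>M\<^esub> n = \<zero>\<^bsub>R\<^esub> \<odot>\<^bsub>M\<^esub> m" using n mc by simp
        then show "\<zero>\<^bsub>R\<^esub> \<in> J" unfolding J_def by blast
        fix a b assume "a \<in> J" "b \<in> J"
        then obtain r r' where h: "a \<in> carrier R" "b \<in> carrier R" "r \<in> carrier R" "r' \<in> carrier R"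
          "a \<odot>\<^bsub>M\<^esub> n = r \<odot>\<^bsub>M\<^esub> m" "b \<odot>\<^bsub>M\<^esub> n = r' \<odot>\<^bsub>M\<^esub> m" by (auto simp: J_def)
        then have "(a \<oplus>\<^bsub>R\<^esub> b) \<odot>\<^bsub>M\<^esub> n = (r \<oplus>\<^bsub>R\<^esub> r') \<odot>\<^bsub>M\<^esub> m" using n mc by (simp add: M.smult_l_distr)
        then show "a \<oplus>\<^bsub>R\<^esub> b \<in> J" unfolding J_def using h by blast
      next
        fix c a assume c: "c \<in> carrier R" and "a \<in> J"
        then obtain r where h: "a \<in> carrier R" "r \<in> carrier R" "a \<odot>\<^bsub>M\<^esub> n = r \<odot>\<^bsub>M\<^esub> m"
          by (auto simp: J_def)
        then have "(c \<otimes>\<^bsub>R\<^esub> a) \<odot>\<^bsub>M\<^esub> n = (c \<otimes>\<^bsub>R\<^esub> r) \<odot>\<^bsub>M\<^esub> m" using n mc c by (simp add: M.smult_assoc1)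
        then show "c \<otimes>\<^bsub>R\<^esub> a \<in> J" unfolding J_def using h c by blast
      qed
      moreover have "P \<subseteq> J"
      proof
        fix t assume t: "t \<in> P"
        have tc: "t \<in> carrier R" using bspec[OF * m] t by (auto simp: annihilator_def)
        have "t \<odot>\<^bsub>M\<^esub> n = \<zero>\<^bsub>M\<^esub>"
        proof (cases "n = \<zero>\<^bsub>M\<^esub>")
          case True
          then show ?thesis using tc by simp
        next
          case False
          then have "t \<in> ?ann n" using * n t by blast
          then show ?thesis by (simp add: annihilator_def)
        qed
        then have "t \<odot>\<^bsub>M\<^esub> n = \<zero>\<^bsub>R\<^esub> \<odot>\<^bsub>M\<^esub> m" using mc by simp
        then show "t \<in> J" unfolding J_def using tc M.R.zero_closed by blast
      qed
      moreover have "J \<noteq> P" using bspec[OF * m] n unfolding J_def by blast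
      ultimately have "J \<inter> ?nz \<noteq> {}" using maximal_in_Ass_self_eqI[OF cr assms(2) P] by blast
      then show ?thesis unfolding J_def by blast
    qed
    then show ?lhs using * disj by blast
  qed
  also have "?rhs \<longleftrightarrow> (\<exists>\<pp>. ?max \<pp> \<and> (\<exists>h \<in> module_homs R M (residue_module R \<pp>). inj_on h (carrier M)))"
    using embeds_in_residue_module_iff[OF prime assms(3,4)] by blast
  finally show ?thesis unfolding M.simple_torsion_free_iff[OF assms(4)] .
qed

end
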